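(* Let $k$ be an integer with $2\le k\le N$. Let $\Sigma\subset\mathbb{C}^N$ be any compact set whose $k$-polynomial hull $\widehat{\Sigma}^{k}$ is nontrivial (that is, $\widehat{\Sigma}^{k}\setminus\Sigma\neq\emptyset$), and let $x_0\in\widehat{\Sigma}^{k}\setminus\Sigma$. Then $\Sigma$ contains a compact set $X$ such that $x_0$ is in $h_r^{k-1}(X)\setminus X\subset\widehat X\setminus X$ and is a one-point Gleason part for $P(X)$, and $P(X)$ has dense invertibles.
   Context: For a compact set $X\subset\mathbb{C}^N$, the polynomial hull of $X$ is $\widehat X=\{z\in\mathbb{C}^N: |p(z)|\le \max_{x\in X}|p(x)| \text{ for all polynomials } p\}$, where polynomials are holomorphic polynomials in the complex coordinates $z_1,\ldots,z_N$. An analytic subvariety of $\mathbb{C}^N$ of pure codimension $m$ means a pure dimensional analytic subvariety of $\mathbb{C}^N$ of pure dimension $N-m$. For $1\le k\le N$, the $k$-rational hull of a compact set $X\subset\mathbb{C}^N$ is $h_r^k(X)=\{z\in\mathbb{C}^N:$ every analytic subvariety of $\mathbb{C}^N$ of pure codimension $\le k$ that passes through $z$ intersects $X\}$. For $2\le k\le N$, the $k$-polynomial hull of $X$ is $\widehat X^{k}=\{z\in\mathbb{C}^N: z\in h_r^{k-1}(X)$ and $z\in\widehat{X\cap V}$ for every analytic subvariety $V$ of $\mathbb{C}^N$ of pure codimension $\le k-1$ that passes through $z\}$. $P(X)$ denotes the closure, in the algebra $C(X)$ of continuous complex-valued functions on $X$ with the supremum norm, of (the restrictions to $X$ of) the polynomials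 in $z_1,\ldots,z_N$. $P(X)$ has dense invertibles if the set of invertible elements of the algebra $P(X)$ is dense in $P(X)$. The maximal ideal space of $P(X)$ is identified with $\widehat X$: a point $z\in\widehat X$ corresponds to the unique continuous multiplicative linear functional $\varphi_z$ on $P(X)$ with $\varphi_z(p)=p(z)$ for every polynomial $p$. The Gleason parts for $P(X)$ are the equivalence classes in $\widehat X$ under the relation $z\sim w$ iff $\|\varphi_z-\varphi_w\|<2$ in the norm of the dual space $P(X)^*$ (this is an equivalence relation). A point $x_0\in\widehat X$ is a one-point Gleason part for $P(X)$ if $\{x_0\}$ is a Gleason part, i.e., $\|\varphi_{x_0}-\varphi_w\|=2$ for every $w\in\widehat X\setminus\{x_0\}$. *)

theory Defs
  imports "HOL-Analysis.Analysis"
begin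

text \<open>Complex Euclidean space of dimension \<open>N\<close> is \<^typ>\<open>complex ^ 'n\<close> with \<open>N = CARD('n)\<close>.\<close>

subsection \<open>Polynomial hull\<close>

definition polynomial_Cn :: "(complex ^ 'n \<Rightarrow> complex) \<Rightarrow> bool" where
  "polynomial_Cn p \<longleftrightarrow>
     (\<exists>(A :: ('n \<Rightarrow> nat) set) c. finite A \<and>
        p = (\<lambda>z. \<Sum>\<alpha>\<in>A. c \<alpha> * (\<Prod>i\<in>UNIV. (z $ i) ^ \<alpha> i)))"

text \<open>The hull of the empty set is empty; the conjunct \<open>X \<noteq> {}\<close> is there because the
  supremum of the empty set of reals is unspecified. For compact \<open>X\<close> the supremum is a
  maximum.\<close>

definition poly_hull :: "(complex ^ 'n) set \<Rightarrow> (complex ^ 'n) set" where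
  "poly_hull X =
     {z. X \<noteq> {} \<and> (\<forall>p. polynomial_Cn p \<longrightarrow> cmod (p z) \<le> (SUP x\<in>X. cmod (p x)))}"

subsection \<open>Analytic subvarieties\<close>

definition holomorphic_Cn :: "(complex ^ 'n \<Rightarrow> complex) \<Rightarrow> (complex ^ 'n) set \<Rightarrow> bool" where
  "holomorphic_Cn f U \<longleftrightarrow>
     (\<forall>z\<in>U. \<exists>D. (f has_derivative D) (at z) \<and> (\<forall>c v. D (c *s v) = c * D v))"

text \<open>The local equations are required around every point of the ambient space, not only
  around the points of \<open>V\<close>; in particular \<open>V\<close> is closed.\<close>

definition analytic_subvariety :: "(complex ^ 'n) set \<Rightarrow> bool" where
  "analytic_subvariety V \<longleftrightarrow>
     (\<forall>a. \<exists>U F. open U \<and> a \<in> U \<and> finite F \<and> (\<forall>f\<in>F. holomorphic_Cn f U) \<and>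
        V \<inter> U = {z \<in> U. \<forall>f\<in>F. f z = 0})"

text \<open>\<open>a\<close> is a regular point of \<open>V\<close> of dimension \<open>d\<close>: near \<open>a\<close>, a biholomorphic change of
  coordinates turns \<open>V\<close> into a \<open>d\<close>-dimensional coordinate plane.\<close>

definition regular_point :: "(complex ^ 'n) set \<Rightarrow> nat \<Rightarrow> complex ^ 'n \<Rightarrow> bool" where
  "regular_point V d a \<longleftrightarrow> a \<in> V \<and>
     (\<exists>U W \<Phi> \<Psi> (J :: 'n set).
        open U \<and> a \<in> U \<and> open W \<and> homeomorphism U W \<Phi> \<Psi> \<and>
        (\<forall>i. holomorphic_Cn (\<lambda>z. \<Phi> z $ i) U) \<and> (\<forall>i. holomorphic_Cn (\<lambda>w. \<Psi> w $ i) W) \<and>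
        card J = d \<and> \<Phi> ` (V \<inter> U) = {w \<in> W. \<forall>i. i \<notin> J \<longrightarrow> w $ i = 0})"

text \<open>The dimension of \<open>V\<close> at \<open>a\<close> is the upper limit, as regular points tend to \<open>a\<close>, of
  their dimensions.\<close>

definition dim_at :: "(complex ^ 'n) set \<Rightarrow> complex ^ 'n \<Rightarrow> nat" where
  "dim_at V a = Max {d. \<forall>U. open U \<and> a \<in> U \<longrightarrow> (\<exists>b\<in>U. regular_point V d b)}"

definition pure_dim :: "(complex ^ 'n) set \<Rightarrow> nat \<Rightarrow> bool" where
  "pure_dim V d \<longleftrightarrow> (\<forall>a\<in>V. dim_at V a = d)"

definition pure_codim_subvariety :: "nat \<Rightarrow> (complex ^ 'n) set \<Rightarrow> bool" where
  "pure_codim_subvariety m V \<longleftrightarrow>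
     m \<le> CARD('n) \<and> analytic_subvariety V \<and> pure_dim V (CARD('n) - m)"

subsection \<open>The \<open>k\<close>-rational and \<open>k\<close>-polynomial hulls\<close>

definition k_rational_hull :: "nat \<Rightarrow> (complex ^ 'n) set \<Rightarrow> (complex ^ 'n) set" where
  "k_rational_hull k X =
     {z. \<forall>m V. m \<le> k \<and> pure_codim_subvariety m V \<and> z \<in> V \<longrightarrow> V \<inter> X \<noteq> {}}"

definition k_polynomial_hull :: "nat \<Rightarrow> (complex ^ 'n) set \<Rightarrow> (complex ^ 'n) set" where
  "k_polynomial_hull k X =
     {z. z \<in> k_rational_hull (k - 1) X \<and>
         (\<forall>m V. m \<le> k - 1 \<and> pure_codim_subvariety m V \<and> z \<in> V \<longrightarrow> z \<in> poly_hull (X \<inter> V))}"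

subsection \<open>The uniform algebra \<open>P(X)\<close>\<close>

text \<open>Elements of \<open>C(X)\<close> are represented by functions that are \<open>undefined\<close> outside \<open>X\<close>, so
  that equality of elements is equality of functions; the metric is the supremum metric.\<close>

abbreviation C_metric :: "(complex ^ 'n) set \<Rightarrow> (complex ^ 'n \<Rightarrow> complex) metric" where
  "C_metric X \<equiv> cfunspace (top_of_set X) euclidean_metric"

definition sup_norm :: "(complex ^ 'n) set \<Rightarrow> (complex ^ 'n \<Rightarrow> complex) \<Rightarrow> real" where
  "sup_norm X f = (SUP x\<in>X. cmod (f x))"

definition PX :: "(complex ^ 'n) set \<Rightarrow> (complex ^ 'n \<Rightarrow> complex) set" where
  "PX X = mtopology_of (C_metric X) closure_of {restrict p X | p. polynomial_Cn p}"

definition invertible_in_PX :: "(complex ^ 'n) set \<Rightarrow> (complex ^ 'n \<Rightarrow> complex) \<Rightarrow> bool" where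
  "invertible_in_PX X f \<longleftrightarrow> f \<in> PX X \<and> (\<exists>g\<in>PX X. \<forall>x\<in>X. f x * g x = 1)"

definition dense_invertibles :: "(complex ^ 'n) set \<Rightarrow> bool" where
  "dense_invertibles X \<longleftrightarrow>
     PX X \<subseteq> mtopology_of (C_metric X) closure_of {f. invertible_in_PX X f}"

subsection \<open>Gleason parts for \<open>P(X)\<close>\<close>

definition mult_functional ::
    "(complex ^ 'n) set \<Rightarrow> ((complex ^ 'n \<Rightarrow> complex) \<Rightarrow> complex) \<Rightarrow> bool" where
  "mult_functional X \<phi> \<longleftrightarrow>
     continuous_map (subtopology (mtopology_of (C_metric X)) (PX X)) euclidean \<phi> \<and>
     (\<forall>f\<in>PX X. \<forall>g\<in>PX X. \<phi> (\<lambda>x\<in>X. f x + g x) = \<phi> f + \<phi> g) \<and>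
     (\<forall>c. \<forall>f\<in>PX X. \<phi> (\<lambda>x\<in>X. c * f x) = c * \<phi> f) \<and>
     (\<forall>f\<in>PX X. \<forall>g\<in>PX X. \<phi> (\<lambda>x\<in>X. f x * g x) = \<phi> f * \<phi> g)"

text \<open>Extensionality makes the description unique; it is meaningful for \<open>z \<in> poly_hull X\<close>.\<close>

definition point_functional ::
    "(complex ^ 'n) set \<Rightarrow> complex ^ 'n \<Rightarrow> (complex ^ 'n \<Rightarrow> complex) \<Rightarrow> complex" where
  "point_functional X z =
     (THE \<phi>. \<phi> \<in> extensional (PX X) \<and> mult_functional X \<phi> \<and>
        (\<forall>p. polynomial_Cn p \<longrightarrow> \<phi> (restrict p X) = p z))"

definition dual_dist :: "(complex ^ 'n) set \<Rightarrow> complex ^ 'n \<Rightarrow> complex ^ 'n \<Rightarrow> real" where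
  "dual_dist X z w =
     (SUP f\<in>{f \<in> PX X. sup_norm X f \<le> 1}. cmod (point_functional X z f - point_functional X w f))"

definition gleason_rel :: "(complex ^ 'n) set \<Rightarrow> (complex ^ 'n) rel" where
  "gleason_rel X = {(z, w). z \<in> poly_hull X \<and> w \<in> poly_hull X \<and> dual_dist X z w < 2}"

definition gleason_parts :: "(complex ^ 'n) set \<Rightarrow> (complex ^ 'n) set set" where
  "gleason_parts X = poly_hull X // gleason_rel X"

definition one_point_gleason_part :: "(complex ^ 'n) set \<Rightarrow> complex ^ 'n \<Rightarrow> bool" where
  "one_point_gleason_part X x \<longleftrightarrow> {x} \<in> gleason_parts X"

end

theory Submission
  imports Defs "HOL-Complex_Analysis.Conformal_Mappings"
begin

text \<open>
The idea is to force a sequence of polynomials \<open>Q\<^sub>n\<close> with \<open>Q\<^sub>n x0 = 1\<close> to have real part at least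
\<open>1/2\<close> on \<open>X\<close>. Let \<open>p\<^sub>n\<close> be countably many polynomials with \<open>p\<^sub>n x0 = 1\<close> whose multiples are dense
in \<open>P(X)\<close>. Given \<open>Q\<^sub>n\<close>, put \<open>Q\<^sub>n\<^sub>+\<^sub>1 = p\<^sub>n \<cdot> g\<^sub>n(Q\<^sub>n)\<close>, where \<open>g\<^sub>n\<close> is a polynomial in one variable
with \<open>g\<^sub>n(1) = 1\<close> that is so small on the bounded set of values of \<open>Q\<^sub>n\<close> on \<open>S\<close> with real part below
\<open>1/2\<close> that \<open>|Q\<^sub>n\<^sub>+\<^sub>1| \<le> 1/4\<close> wherever \<open>Re Q\<^sub>n < 1/2\<close> on \<open>S\<close> (\<open>damping_factor\<close>,
\<open>polynomial_tower\<close>). Then the compact sets \<open>{x \<in> S. Re (Q\<^sub>n x) \<ge> 1/2}\<close> decrease, and \<open>X\<close> is their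
intersection (\<open>compact_subset_from_tower\<close>).

Rational hull: let \<open>V\<close> be a subvariety through \<open>x0\<close> of codimension at most \<open>k - 1\<close>, so that \<open>x0\<close> is
in the polynomial hull of \<open>S \<inter> V\<close>. If \<open>Re Q\<^sub>n < 1/2\<close> on \<open>S \<inter> V\<close>, then \<open>|Q\<^sub>n\<^sub>+\<^sub>1| \<le> 1/4\<close> on
\<open>S \<inter> V\<close> although \<open>Q\<^sub>n\<^sub>+\<^sub>1 x0 = 1\<close>, which is absurd. So \<open>V\<close> meets each of the decreasing compact
sets, hence \<open>X\<close>.

Dense invertibles: since \<open>Re Q\<^sub>n\<^sub>+\<^sub>1 \<ge> 1/2\<close> on \<open>X\<close>, a geometric series shows that \<open>Q\<^sub>n\<^sub>+\<^sub>1\<close> is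
invertible in \<open>P(X)\<close>; hence so is its divisor \<open>p\<^sub>n\<close>.

Gleason part: let \<open>w \<noteq> x0\<close> be a point of the polynomial hull of \<open>X\<close>. The degree of \<open>g\<^sub>n\<close> is chosen
so that a bound \<open>|Q\<^sub>n w| \<le> C\<close> yields a bound on \<open>|g\<^sub>n(Q\<^sub>n w)|\<close> that depends only on \<open>C\<close> and on
\<open>sup\<^sub>S |p\<^sub>n|\<close>. Some of the \<open>p\<^sub>n\<close> are arbitrarily small at \<open>w\<close> while \<open>sup\<^sub>S |p\<^sub>n|\<close> stays bounded, and
\<open>|p\<^sub>n w| |g\<^sub>n(Q\<^sub>n w)| = |Q\<^sub>n\<^sub>+\<^sub>1 w| \<ge> 1/2\<close>; so \<open>Q\<^sub>n w\<close> is unbounded in \<open>n\<close>. A Cayley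
transform of the half-plane \<open>Re \<ge> 1/2\<close> turns this into functions in the unit ball of \<open>P(X)\<close> that are
close to \<open>1\<close> at \<open>x0\<close> and close to \<open>-1\<close> at \<open>w\<close> (\<open>one_point_gleason_partI\<close>).

That rational hulls lie in polynomial hulls rests on a fact about the definitions of dimension by
regular points: the zero set of a nonzero polynomial has pure codimension one
(\<open>hypersurface_pure_codim_1\<close>).
\<close>

section \<open>Polynomials on complex Euclidean space\<close>

lemma polynomial_Cn_const: "polynomial_Cn (\<lambda>z. k)"
  unfolding polynomial_Cn_def
  by (rule exI[of _ "{\<lambda>i. 0}"], rule exI[of _ "\<lambda>_. k"]) auto

lemma polynomial_Cn_coord: "polynomial_Cn (\<lambda>z :: complex ^ 'n. z $ i)"
proof -
  have "z $ i = (\<Prod>j\<in>UNIV. (z $ j) ^ (if j = i then 1 else 0))" for z :: "complex ^ 'n"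
  proof -
    have "(\<Prod>j\<in>UNIV. (z $ j) ^ (if j = i then 1 else 0)) = (\<Prod>j\<in>UNIV. if j = i then z $ j else 1)"
      by (rule prod.cong) auto
    then show ?thesis by simp
  qed
  then show ?thesis
    unfolding polynomial_Cn_def
    by (intro exI[of _ "{\<lambda>j. if j = i then 1 else 0}"] exI[of _ "\<lambda>_. 1"]) auto
qed

lemma polynomial_Cn_add:
  assumes "polynomial_Cn p" "polynomial_Cn q"
  shows "polynomial_Cn (\<lambda>z. p z + q z)"
proof -
  obtain A c where A: "finite A" "p = (\<lambda>z. \<Sum>\<alpha>\<in>A. c \<alpha> * (\<Prod>i\<in>UNIV. (z $ i) ^ \<alpha> i))"
    using assms(1) unfolding polynomial_Cn_def by blast
  obtain B d where B: "finite B" "q = (\<lambda>z. \<Sum>\<alpha>\<in>B. d \<alpha> * (\<Prod>i\<in>UNIV. (z $ i) ^ \<alpha> i))"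
    using assms(2) unfolding polynomial_Cn_def by blast
  define e where "e \<alpha> = (if \<alpha> \<in> A then c \<alpha> else 0) + (if \<alpha> \<in> B then d \<alpha> else 0)" for \<alpha>
  have "p z + q z = (\<Sum>\<alpha>\<in>A \<union> B. e \<alpha> * (\<Prod>i\<in>UNIV. (z $ i) ^ \<alpha> i))" for z
  proof -
    have "p z = (\<Sum>\<alpha>\<in>A \<union> B. (if \<alpha> \<in> A then c \<alpha> else 0) * (\<Prod>i\<in>UNIV. (z $ i) ^ \<alpha> i))"
      unfolding A(2) by (rule sum.mono_neutral_cong_left) (use A(1) B(1) in auto)
    moreover have "q z = (\<Sum>\<alpha>\<in>A \<union> B. (if \<alpha> \<in> B then d \<alpha> else 0) * (\<Prod>i\<in>UNIV. (z $ i) ^ \<alpha> i))"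
      unfolding B(2) by (rule sum.mono_neutral_cong_left) (use A(1) B(1) in auto)
    ultimately show ?thesis
      by (simp add: e_def sum.distrib distrib_right)
  qed
  then show ?thesis
    unfolding polynomial_Cn_def using A(1) B(1) by (intro exI[of _ "A \<union> B"] exI[of _ e]) auto
qed

lemma polynomial_Cn_sum:
  assumes "\<And>i. i \<in> I \<Longrightarrow> polynomial_Cn (f i)"
  shows "polynomial_Cn (\<lambda>z. \<Sum>i\<in>I. f i z)"
  using assms
  by (induction I rule: infinite_finite_induct)
     (auto intro: polynomial_Cn_add polynomial_Cn_const)

lemma polynomial_Cn_mult:
  assumes "polynomial_Cn p" "polynomial_Cn q"
  shows "polynomial_Cn (\<lambda>z. p z * q z)"
proof -
  obtain A c where A: "finite A" "p = (\<lambda>z. \<Sum>\<alpha>\<in>A. c \<alpha> * (\<Prod>i\<in>UNIV. (z $ i) ^ \<alpha> i))"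
    using assms(1) unfolding polynomial_Cn_def by blast
  obtain B d where B: "finite B" "q = (\<lambda>z. \<Sum>\<alpha>\<in>B. d \<alpha> * (\<Prod>i\<in>UNIV. (z $ i) ^ \<alpha> i))"
    using assms(2) unfolding polynomial_Cn_def by blast
  have "polynomial_Cn (\<lambda>z. c \<alpha> * d \<beta> * (\<Prod>i\<in>UNIV. (z $ i) ^ (\<alpha> i + \<beta> i)))" for \<alpha> \<beta>
    unfolding polynomial_Cn_def
    by (intro exI[of _ "{\<lambda>i. \<alpha> i + \<beta> i}"] exI[of _ "\<lambda>_. c \<alpha> * d \<beta>"]) auto
  then have "polynomial_Cn (\<lambda>z. \<Sum>\<alpha>\<in>A. \<Sum>\<beta>\<in>B. c \<alpha> * d \<beta> * (\<Prod>i\<in>UNIV. (z $ i) ^ (\<alpha> i + \<beta> i)))"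
    by (intro polynomial_Cn_sum)
  moreover have "p z * q z = (\<Sum>\<alpha>\<in>A. \<Sum>\<beta>\<in>B. c \<alpha> * d \<beta> * (\<Prod>i\<in>UNIV. (z $ i) ^ (\<alpha> i + \<beta> i)))" for z
    unfolding A(2) B(2)
    by (simp add: sum_product power_add prod.distrib mult_ac)
  ultimately show ?thesis by simp
qed

lemma polynomial_Cn_power: "polynomial_Cn p \<Longrightarrow> polynomial_Cn (\<lambda>z. p z ^ m)"
  by (induction m) (auto intro: polynomial_Cn_mult polynomial_Cn_const)

lemma polynomial_Cn_cmult: "polynomial_Cn p \<Longrightarrow> polynomial_Cn (\<lambda>z. k * p z)"
  by (intro polynomial_Cn_mult polynomial_Cn_const)

lemma polynomial_Cn_diff:
  assumes "polynomial_Cn p" "polynomial_Cn q"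
  shows "polynomial_Cn (\<lambda>z. p z - q z)"
  using polynomial_Cn_add[OF assms(1) polynomial_Cn_cmult[OF assms(2), of "-1"]] by simp

lemma polynomial_Cn_divide: "polynomial_Cn p \<Longrightarrow> polynomial_Cn (\<lambda>z. p z / k)"
  using polynomial_Cn_cmult[of p "inverse k"] by (simp add: field_simps)

lemmas polynomial_Cn_intros =
  polynomial_Cn_const polynomial_Cn_coord polynomial_Cn_add polynomial_Cn_diff
  polynomial_Cn_mult polynomial_Cn_power polynomial_Cn_divide polynomial_Cn_sum

lemma polynomial_Cn_induct [consumes 1, case_names const coord add mult]:
  fixes p :: "complex ^ 'n \<Rightarrow> complex"
  assumes p: "polynomial_Cn p"
    and const: "\<And>k. P (\<lambda>z. k)"
    and coord: "\<And>i. P (\<lambda>z. z $ i)"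
    and add: "\<And>p q. \<lbrakk>polynomial_Cn p; polynomial_Cn q; P p; P q\<rbrakk> \<Longrightarrow> P (\<lambda>z. p z + q z)"
    and mult: "\<And>p q. \<lbrakk>polynomial_Cn p; polynomial_Cn q; P p; P q\<rbrakk> \<Longrightarrow> P (\<lambda>z. p z * q z)"
  shows "P p"
proof -
  define Q where "Q f \<longleftrightarrow> polynomial_Cn f \<and> P f" for f
  have Q: "Q (\<lambda>z. k)" "Q (\<lambda>z. z $ i)" "Q f \<Longrightarrow> Q g \<Longrightarrow> Q (\<lambda>z. f z + g z)"
    "Q f \<Longrightarrow> Q g \<Longrightarrow> Q (\<lambda>z. f z * g z)" for k i f g
    unfolding Q_def using const coord add mult by (auto intro: polynomial_Cn_intros)
  obtain A c where A: "finite A" "p = (\<lambda>z. \<Sum>\<alpha>\<in>A. c \<alpha> * (\<Prod>i\<in>UNIV. (z $ i) ^ \<alpha> i))"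
    using p unfolding polynomial_Cn_def by blast
  have pow: "Q (\<lambda>z. (z $ i) ^ m)" for i m
    by (induction m) (auto intro: Q)
  have "Q (\<lambda>z. \<Prod>i\<in>I. (z $ i) ^ \<alpha> i)" if "finite I" for I and \<alpha> :: "'n \<Rightarrow> nat"
    using that by induction (auto intro: Q pow)
  then have mon: "Q (\<lambda>z. c \<alpha> * (\<Prod>i\<in>UNIV. (z $ i) ^ \<alpha> i))" for \<alpha>
    by (intro Q) auto
  have "Q p"
    unfolding A(2) using A(1) by induction (auto intro: Q mon)
  then show ?thesis by (simp add: Q_def)
qed

lemma polynomial_Cn_continuous: "polynomial_Cn p \<Longrightarrow> continuous_on T p"
proof (induction rule: polynomial_Cn_induct)
  case (coord i)
  then show ?case by (intro continuous_intros)
qed (auto intro: continuous_intros)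

lemma polynomial_Cn_bounded:
  assumes "polynomial_Cn p" "compact T"
  obtains B where "B \<ge> 1" "\<And>x. x \<in> T \<Longrightarrow> cmod (p x) \<le> B"
proof -
  have "bounded (p ` T)"
    using assms by (intro compact_imp_bounded compact_continuous_image polynomial_Cn_continuous)
  then obtain B where "\<forall>x\<in>T. cmod (p x) \<le> B"
    unfolding bounded_iff by auto
  then show ?thesis
    using that[of "max 1 B"] by (auto simp: le_max_iff_disj)
qed

text \<open>Stating the derivative through polynomial partial derivatives gives at the same time complex
linearity, continuity of the derivative, and the possibility to differentiate again.\<close>

lemma polynomial_Cn_has_derivative:
  fixes p :: "complex ^ 'n \<Rightarrow> complex"
  assumes "polynomial_Cn p"
  shows "\<exists>q. (\<forall>i. polynomial_Cn (q i)) \<and>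
           (\<forall>z. (p has_derivative (\<lambda>h. \<Sum>i\<in>UNIV. q i z * h $ i)) (at z))"
  using assms
proof (induction rule: polynomial_Cn_induct)
  case (const k)
  show ?case
    by (intro exI[of _ "\<lambda>i z. 0"]) (auto intro: polynomial_Cn_const)
next
  case (coord j)
  have "(\<Sum>i\<in>UNIV. (if i = j then 1 else 0) * h $ i) = h $ j" for h :: "complex ^ 'n"
    by (simp add: if_distrib[of "\<lambda>x. x * _"] cong: if_cong)
  moreover have "((\<lambda>z::complex ^ 'n. z $ j) has_derivative (\<lambda>h. h $ j)) (at z)" for z
    by (intro bounded_linear_imp_has_derivative bounded_linear_vec_nth)
  ultimately show ?case
    by (intro exI[of _ "\<lambda>i z. if i = j then 1 else 0"]) (auto intro: polynomial_Cn_const)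
next
  case (add p q)
  obtain a b where "\<forall>i. polynomial_Cn (a i)" "\<forall>i. polynomial_Cn (b i)"
    and D: "\<forall>z. (p has_derivative (\<lambda>h. \<Sum>i\<in>UNIV. a i z * h $ i)) (at z)"
      "\<forall>z. (q has_derivative (\<lambda>h. \<Sum>i\<in>UNIV. b i z * h $ i)) (at z)"
    using add.IH by blast
  then show ?case
    using has_derivative_add[OF D(1)[rule_format] D(2)[rule_format]]
    by (intro exI[of _ "\<lambda>i z. a i z + b i z"])
       (auto intro: polynomial_Cn_add simp: sum.distrib distrib_right)
next
  case (mult p q)
  obtain a b where pol: "\<forall>i. polynomial_Cn (a i)" "\<forall>i. polynomial_Cn (b i)"
    and D: "\<forall>z. (p has_derivative (\<lambda>h. \<Sum>i\<in>UNIV. a i z * h $ i)) (at z)"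
      "\<forall>z. (q has_derivative (\<lambda>h. \<Sum>i\<in>UNIV. b i z * h $ i)) (at z)"
    using mult.IH by blast
  have "(\<Sum>i\<in>UNIV. (p z * b i z + a i z * q z) * h $ i) =
    p z * (\<Sum>i\<in>UNIV. b i z * h $ i) + (\<Sum>i\<in>UNIV. a i z * h $ i) * q z" for z h
    by (simp add: sum.distrib sum_distrib_left sum_distrib_right algebra_simps)
  moreover have "polynomial_Cn (\<lambda>z. p z * b i z + a i z * q z)" for i
    using pol mult.hyps by (intro polynomial_Cn_add polynomial_Cn_mult) auto
  ultimately show ?case
    using has_derivative_mult[OF D(1)[rule_format] D(2)[rule_format]]
    by (intro exI[of _ "\<lambda>i z. p z * b i z + a i z * q z"]) auto
qed

lemma polynomial_Cn_on_line:
  fixes p :: "complex ^ 'n \<Rightarrow> complex"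
  assumes "polynomial_Cn p"
  shows "\<exists>C. \<forall>z t. p (z + t *s v) = poly (C z) t"
  using assms
proof (induction rule: polynomial_Cn_induct)
  case (const c)
  show ?case
    by (intro exI[of _ "\<lambda>z. [:c:]"]) simp
next
  case (coord i)
  show ?case
    by (intro exI[of _ "\<lambda>z. [:z $ i, v $ i:]"]) (simp add: mult.commute)
next
  case (add p q)
  obtain C D where "\<forall>z t. p (z + t *s v) = poly (C z) t" "\<forall>z t. q (z + t *s v) = poly (D z) t"
    using add.IH by blast
  then show ?case
    by (intro exI[of _ "\<lambda>z. C z + D z"]) simp
next
  case (mult p q)
  obtain C D where "\<forall>z t. p (z + t *s v) = poly (C z) t" "\<forall>z t. q (z + t *s v) = poly (D z) t"
    using mult.IH by blast
  then show ?case
    by (intro exI[of _ "\<lambda>z. C z * D z"]) simp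
qed

text \<open>On the complex line that joins \<open>b\<close> to \<open>z\<close> the polynomial restricts to one in a single variable with
infinitely many zeros.\<close>

lemma polynomial_Cn_identity:
  fixes p :: "complex ^ 'n \<Rightarrow> complex"
  assumes p: "polynomial_Cn p" and U: "open U" "b \<in> U" and 0: "\<And>z. z \<in> U \<Longrightarrow> p z = 0"
  shows "p z = 0"
proof -
  obtain C where C: "\<And>y t. p (y + t *s (z - b)) = poly (C y) t"
    using polynomial_Cn_on_line[OF p, of "z - b"] by blast
  have "continuous_on UNIV (\<lambda>t::complex. b + t *s (z - b))"
    unfolding vector_scalar_mult_def by (intro continuous_intros continuous_on_vec_lambda)
  then have "open ((\<lambda>t. b + t *s (z - b)) -` U)"
    using U(1) by (intro open_vimage) auto
  moreover have "0 \<in> (\<lambda>t. b + t *s (z - b)) -` U"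
    using U(2) by simp
  ultimately obtain e where e: "e > 0" "ball 0 e \<subseteq> (\<lambda>t. b + t *s (z - b)) -` U"
    by (meson open_contains_ball)
  have "infinite (ball (0::complex) e)"
    using e(1) uncountable_ball countable_finite by blast
  moreover have "ball 0 e \<subseteq> {t. poly (C b) t = 0}"
    using e(2) 0 by (auto simp flip: C)
  ultimately have "C b = 0"
    using poly_roots_finite[of "C b"] finite_subset by blast
  then show ?thesis
    using C[of b 1] by simp
qed

lemma poly_hull_bound:
  assumes "w \<in> poly_hull X" "polynomial_Cn p" "\<And>x. x \<in> X \<Longrightarrow> cmod (p x) \<le> B"
  shows "cmod (p w) \<le> B"
proof -
  have "cmod (p w) \<le> (SUP x\<in>X. cmod (p x))" "X \<noteq> {}"
    using assms(1,2) by (auto simp: poly_hull_def)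
  moreover have "(SUP x\<in>X. cmod (p x)) \<le> B"
    using assms(3) \<open>X \<noteq> {}\<close> by (intro cSUP_least) auto
  ultimately show ?thesis by linarith
qed

text \<open>Polynomials with coefficients in a countable dense set of complex numbers, encoded as lists of terms,
are dense uniformly on every compact set at once.\<close>

lemma countable_dense_polynomials:
  obtains D :: "(complex ^ 'n \<Rightarrow> complex) set"
  where "countable D" "\<And>r. r \<in> D \<Longrightarrow> polynomial_Cn r"
    "\<And>p T e. \<lbrakk>polynomial_Cn p; compact T; e > 0\<rbrakk> \<Longrightarrow> \<exists>r\<in>D. \<forall>x\<in>T. cmod (p x - r x) \<le> e"
proof -
  obtain E :: "complex set" where E: "countable E"
    "\<And>X. open X \<Longrightarrow> X \<noteq> {} \<Longrightarrow> \<exists>d\<in>E. d \<in> X"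
    using countable_dense_setE by blast
  define mon where "mon \<alpha> z = (\<Prod>i\<in>UNIV. (z $ i) ^ \<alpha> i)" for \<alpha> and z :: "complex ^ 'n"
  define ev where "ev xs z = (\<Sum>(c, \<alpha>)\<leftarrow>xs. c * mon \<alpha> z)" for xs and z :: "complex ^ 'n"
  have mon: "polynomial_Cn (\<lambda>z. c * mon \<alpha> z)" for c \<alpha>
    unfolding polynomial_Cn_def mon_def
    by (intro exI[of _ "{\<alpha>}"] exI[of _ "\<lambda>_. c"]) auto
  have ev: "polynomial_Cn (ev xs)" for xs
  proof (induction xs)
    case Nil
    then show ?case by (simp add: ev_def polynomial_Cn_const)
  next
    case (Cons x xs)
    then have "polynomial_Cn (\<lambda>z. fst x * mon (snd x) z + ev xs z)"
      by (intro polynomial_Cn_add mon)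
    then show ?case by (simp add: ev_def case_prod_unfold)
  qed
  define D where "D = ev ` lists (E \<times> UNIV)"
  have "\<exists>r\<in>D. \<forall>x\<in>T. cmod ((\<Sum>\<alpha>\<in>A. c \<alpha> * mon \<alpha> x) - r x) \<le> e"
    if "finite A" "e > 0" "compact T" for A and c :: "('n \<Rightarrow> nat) \<Rightarrow> complex" and T e
    using that
  proof (induction A arbitrary: e rule: finite_induct)
    case empty
    have "ev [] \<in> D" by (auto simp: D_def)
    then show ?case using empty by (intro bexI[of _ "ev []"]) (auto simp: ev_def)
  next
    case (insert \<alpha> A)
    obtain r where r: "r \<in> D" "\<forall>x\<in>T. cmod ((\<Sum>\<alpha>\<in>A. c \<alpha> * mon \<alpha> x) - r x) \<le> e / 2"
      using insert.IH[of "e / 2"] insert.prems by auto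
    then obtain xs where xs: "xs \<in> lists (E \<times> UNIV)" "r = ev xs"
      unfolding D_def by blast
    obtain B where B: "B \<ge> 1" "\<And>x. x \<in> T \<Longrightarrow> cmod (mon \<alpha> x) \<le> B"
      using polynomial_Cn_bounded[OF mon[of 1 \<alpha>] \<open>compact T\<close>] by auto
    have "e / (2 * B) > 0"
      using B(1) \<open>e > 0\<close> by (intro divide_pos_pos) auto
    then have "ball (c \<alpha>) (e / (2 * B)) \<noteq> {}"
      by simp
    then obtain d where d: "d \<in> E" "cmod (c \<alpha> - d) < e / (2 * B)"
      using E(2)[of "ball (c \<alpha>) (e / (2 * B))"] by (auto simp: dist_norm)
    have "ev ((d, \<alpha>) # xs) \<in> D"
      unfolding D_def using d xs by auto
    moreover have "cmod ((\<Sum>\<alpha>\<in>insert \<alpha> A. c \<alpha> * mon \<alpha> x) - ev ((d, \<alpha>) # xs) x) \<le> e" if "x \<in> T" for x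
    proof -
      have "cmod ((c \<alpha> - d) * mon \<alpha> x) \<le> e / (2 * B) * B"
        unfolding norm_mult using d(2) B that \<open>e / (2 * B) > 0\<close> by (intro mult_mono) auto
      then have 1: "cmod ((c \<alpha> - d) * mon \<alpha> x) \<le> e / 2"
        using B(1) by simp
      have 2: "cmod ((\<Sum>\<alpha>\<in>A. c \<alpha> * mon \<alpha> x) - ev xs x) \<le> e / 2"
        using r(2) xs(2) that by auto
      have "(\<Sum>\<alpha>\<in>insert \<alpha> A. c \<alpha> * mon \<alpha> x) - ev ((d, \<alpha>) # xs) x =
          (c \<alpha> - d) * mon \<alpha> x + ((\<Sum>\<alpha>\<in>A. c \<alpha> * mon \<alpha> x) - ev xs x)"
        using insert.hyps by (simp add: ev_def algebra_simps)
      then show ?thesis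
        using norm_triangle_mono[OF 1 2] by simp
    qed
    ultimately show ?case by blast
  qed
  then have "\<exists>r\<in>D. \<forall>x\<in>T. cmod (p x - r x) \<le> e"
    if "polynomial_Cn p" "compact T" "e > 0" for p T e
    using that unfolding polynomial_Cn_def mon_def[abs_def] by fast
  moreover have "countable D"
    unfolding D_def using E(1) by (intro countable_image countable_lists countable_SIGMA) auto
  moreover have "polynomial_Cn r" if "r \<in> D" for r
    using that ev by (auto simp: D_def)
  ultimately show ?thesis using that by blast
qed

section \<open>The algebra P(X)\<close>

lemma continuous_in_C_metric:
  assumes "compact X" "continuous_on X f" "f \<in> extensional X"
  shows "f \<in> mspace (C_metric X)"
proof -
  have "bounded (f ` X)"
    using assms by (intro compact_imp_bounded compact_continuous_image)
  then show ?thesis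
    using assms by simp
qed

lemma C_metric_mdist_le:
  assumes "f \<in> mspace (C_metric X)" "g \<in> mspace (C_metric X)" "X \<noteq> {}"
  shows "mdist (C_metric X) f g \<le> a \<longleftrightarrow> (\<forall>x\<in>X. cmod (f x - g x) \<le> a)"
  using cfunspace_mdist_le[OF assms(1,2)] assms(3) by (simp add: dist_norm)

lemma C_metric_closure_of:
  assumes X: "X \<noteq> {}" and T: "T \<subseteq> mspace (C_metric X)"
  shows "f \<in> mtopology_of (C_metric X) closure_of T \<longleftrightarrow>
    f \<in> mspace (C_metric X) \<and> (\<forall>e>0. \<exists>g\<in>T. \<forall>x\<in>X. cmod (f x - g x) \<le> e)"
proof -
  interpret M: Metric_space "mspace (C_metric X)" "mdist (C_metric X)"
    by (rule Metric_space_mspace_mdist)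
  have "(\<exists>g\<in>T. g \<in> M.mcball f e) \<longleftrightarrow> (\<exists>g\<in>T. \<forall>x\<in>X. cmod (f x - g x) \<le> e)"
    if "f \<in> mspace (C_metric X)" for e
    using T that C_metric_mdist_le[OF that _ X] by (meson M.in_mcball subsetD)
  then show ?thesis
    unfolding mtopology_of_def M.metric_closure_of_alt by blast
qed

lemma restrict_polynomial_in_C_metric:
  assumes "compact X" "polynomial_Cn p"
  shows "restrict p X \<in> mspace (C_metric X)"
  using assms
  by (intro continuous_in_C_metric) (auto cong: continuous_on_cong intro: polynomial_Cn_continuous)

text \<open>Membership in the closure becomes uniform approximation alone: continuity is inherited by the uniform
limit.\<close>

lemma PX_iff:
  assumes X: "compact X" "X \<noteq> {}"
  shows "f \<in> PX X \<longleftrightarrow> f \<in> extensional X \<and>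
    (\<forall>e>0. \<exists>p. polynomial_Cn p \<and> (\<forall>x\<in>X. cmod (f x - p x) \<le> e))"
proof -
  have T: "{restrict p X | p. polynomial_Cn p} \<subseteq> mspace (C_metric X)"
    using restrict_polynomial_in_C_metric[OF X(1)] by blast
  have 1: "(\<exists>g\<in>{restrict p X | p. polynomial_Cn p}. \<forall>x\<in>X. cmod (f x - g x) \<le> e) \<longleftrightarrow>
      (\<exists>p. polynomial_Cn p \<and> (\<forall>x\<in>X. cmod (f x - p x) \<le> e))" for e
    by auto
  have 2: "f \<in> mspace (C_metric X)" if f: "f \<in> extensional X"
    and app: "\<forall>e>0. \<exists>p. polynomial_Cn p \<and> (\<forall>x\<in>X. cmod (f x - p x) \<le> e)"
  proof (rule continuous_in_C_metric[OF X(1) _ f])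
    have "\<exists>p. polynomial_Cn p \<and> (\<forall>x\<in>X. cmod (f x - p x) \<le> inverse (Suc n))" for n
      using app by simp
    then obtain P where P: "\<And>n. polynomial_Cn (P n)"
      "\<And>n x. x \<in> X \<Longrightarrow> cmod (f x - P n x) \<le> inverse (Suc n)"
      by metis
    have "uniform_limit X P f sequentially"
    proof (rule uniform_limitI)
      fix e :: real assume "e > 0"
      have "eventually (\<lambda>n. inverse (Suc n) < e) sequentially"
        using LIMSEQ_inverse_real_of_nat \<open>e > 0\<close> by (rule order_tendstoD)
      then show "\<forall>\<^sub>F n in sequentially. \<forall>x\<in>X. dist (P n x) (f x) < e"
        by eventually_elim (metis P(2) dist_norm norm_minus_commute order_le_less_trans)
    qed
    moreover have "\<forall>\<^sub>F n in sequentially. continuous_on X (P n)"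
      by (intro always_eventually allI polynomial_Cn_continuous P)
    ultimately show "continuous_on X f"
      by (intro uniform_limit_theorem[where F = sequentially]) auto
  qed
  have "f \<in> mspace (C_metric X) \<Longrightarrow> f \<in> extensional X"
    by simp
  then show ?thesis
    unfolding PX_def C_metric_closure_of[OF X(2) T] 1 using 2 by blast
qed

lemma PX_subset_C_metric: "PX X \<subseteq> mspace (C_metric X)"
  unfolding PX_def
  using closure_of_subset_topspace[of "mtopology_of (C_metric X)"] by (simp only: topspace_mtopology_of)

lemma polynomial_in_PX:
  assumes "compact X" "X \<noteq> {}" "polynomial_Cn p"
  shows "restrict p X \<in> PX X"
  unfolding PX_iff[OF assms(1,2)]
proof (intro conjI allI impI)
  show "\<exists>q. polynomial_Cn q \<and> (\<forall>x\<in>X. cmod (restrict p X x - q x) \<le> e)" if "e > 0" for e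
    using assms(3) that by (intro exI[of _ p]) simp
qed simp

lemma PX_bounded:
  assumes "compact X" "f \<in> PX X"
  obtains B where "B \<ge> 1" "\<And>x. x \<in> X \<Longrightarrow> cmod (f x) \<le> B"
proof -
  have "bounded (f ` X)"
    using PX_subset_C_metric assms(2) by fastforce
  then obtain B where "\<forall>x\<in>X. cmod (f x) \<le> B"
    unfolding bounded_iff by auto
  then show ?thesis
    using that[of "max 1 B"] by (auto simp: le_max_iff_disj)
qed

lemma product_approx:
  fixes a b c d :: complex
  assumes "cmod (a - c) \<le> e" "cmod (b - d) \<le> e'" "cmod b \<le> B" "cmod c \<le> C"
  shows "cmod (a * b - c * d) \<le> e * B + C * e'"
proof -
  have "a * b - c * d = (a - c) * b + c * (b - d)"
    by (simp add: left_diff_distrib right_diff_distrib)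
  then have "cmod (a * b - c * d) \<le> cmod (a - c) * cmod b + cmod c * cmod (b - d)"
    using norm_triangle_ineq[of "(a - c) * b" "c * (b - d)"] by (simp only: norm_mult)
  also have "\<dots> \<le> e * B + C * e'"
    using assms order_trans[OF norm_ge_zero assms(1)] order_trans[OF norm_ge_zero assms(4)]
    by (intro add_mono mult_mono) simp_all
  finally show ?thesis .
qed

lemma PX_add:
  assumes X: "compact X" "X \<noteq> {}" and fg: "f \<in> PX X" "g \<in> PX X"
  shows "(\<lambda>x\<in>X. f x + g x) \<in> PX X"
  unfolding PX_iff[OF X]
proof (intro conjI allI impI)
  fix e :: real assume "e > 0"
  then obtain p q where "polynomial_Cn p" "\<forall>x\<in>X. cmod (f x - p x) \<le> e / 2"
    "polynomial_Cn q" "\<forall>x\<in>X. cmod (g x - q x) \<le> e / 2"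
    using fg unfolding PX_iff[OF X] by (meson half_gt_zero)
  then show "\<exists>p. polynomial_Cn p \<and> (\<forall>x\<in>X. cmod ((\<lambda>x\<in>X. f x + g x) x - p x) \<le> e)"
    using norm_triangle_mono[of "f _ - p _" "e / 2" "g _ - q _" "e / 2"]
    by (intro exI[of _ "\<lambda>x. p x + q x"]) (auto intro: polynomial_Cn_add simp: algebra_simps)
qed auto

lemma PX_mult:
  assumes X: "compact X" "X \<noteq> {}" and fg: "f \<in> PX X" "g \<in> PX X"
  shows "(\<lambda>x\<in>X. f x * g x) \<in> PX X"
  unfolding PX_iff[OF X]
proof (intro conjI allI impI)
  fix e :: real assume e: "e > 0"
  obtain B where B: "B \<ge> 1" "\<And>x. x \<in> X \<Longrightarrow> cmod (g x) \<le> B"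
    using PX_bounded[OF X(1) fg(2)] by blast
  have "e / (2 * B) > 0"
    using e B(1) by simp
  then obtain p where p: "polynomial_Cn p" "\<forall>x\<in>X. cmod (f x - p x) \<le> e / (2 * B)"
    using fg(1) unfolding PX_iff[OF X] by blast
  obtain C where C: "C \<ge> 1" "\<And>x. x \<in> X \<Longrightarrow> cmod (p x) \<le> C"
    using polynomial_Cn_bounded[OF p(1) X(1)] by blast
  have "e / (2 * C) > 0"
    using e C(1) by simp
  then obtain q where q: "polynomial_Cn q" "\<forall>x\<in>X. cmod (g x - q x) \<le> e / (2 * C)"
    using fg(2) unfolding PX_iff[OF X] by blast
  have "cmod (f x * g x - p x * q x) \<le> e" if "x \<in> X" for x
  proof -
    have "cmod (f x * g x - p x * q x) \<le> e / (2 * B) * B + C * (e / (2 * C))"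
      using p q B C that by (intro product_approx) auto
    also have "\<dots> = e"
      using B(1) C(1) by (simp add: field_simps)
    finally show ?thesis .
  qed
  then show "\<exists>p. polynomial_Cn p \<and> (\<forall>x\<in>X. cmod ((\<lambda>x\<in>X. f x * g x) x - p x) \<le> e)"
    using p(1) q(1) by (intro exI[of _ "\<lambda>x. p x * q x"]) (auto intro: polynomial_Cn_mult)
qed auto

lemma PX_cmult:
  assumes X: "compact X" "X \<noteq> {}" and f: "f \<in> PX X"
  shows "(\<lambda>x\<in>X. c * f x) \<in> PX X"
proof -
  have "(\<lambda>x\<in>X. restrict (\<lambda>_. c) X x * f x) \<in> PX X"
    by (intro PX_mult X f polynomial_in_PX polynomial_Cn_const)
  also have "(\<lambda>x\<in>X. restrict (\<lambda>_. c) X x * f x) = (\<lambda>x\<in>X. c * f x)"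
    by (auto simp: fun_eq_iff)
  finally show ?thesis .
qed

text \<open>The values of \<open>q\<close> on \<open>X\<close> lie in a compact subset of the open right half-plane, hence in a disc of radius
\<open>\<rho> a < a\<close> about a large real number \<open>a\<close>, and the geometric series of \<open>1 - q / a\<close> converges
uniformly to \<open>a / q\<close>. The choice \<open>a = R\<^sup>2 / s\<close> makes the cross term \<open>2 a s\<close> twice as large as \<open>R\<^sup>2\<close>.\<close>

lemma PX_inverse_of_polynomial:
  assumes X: "compact X" "X \<noteq> {}" and q: "polynomial_Cn q"
    and s: "s > 0" "\<And>x. x \<in> X \<Longrightarrow> s \<le> Re (q x)"
  shows "(\<lambda>x\<in>X. 1 / q x) \<in> PX X"
  unfolding PX_iff[OF X]
proof (intro conjI allI impI)
  fix e :: real assume e: "e > 0"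
  obtain R where R: "R \<ge> 1" "\<And>x. x \<in> X \<Longrightarrow> cmod (q x) \<le> R"
    using polynomial_Cn_bounded[OF q X(1)] by blast
  define a where "a = R\<^sup>2 / s"
  define \<rho> where "\<rho> = sqrt (a\<^sup>2 - R\<^sup>2) / a"
  have a: "a > 0"
    using R(1) s(1) by (simp add: a_def)
  have \<rho>: "\<rho> < 1"
  proof -
    have "sqrt (a\<^sup>2 - R\<^sup>2) < a"
      using a R(1) by (intro real_less_lsqrt) auto
    then show ?thesis using a by (simp add: \<rho>_def)
  qed
  have u: "cmod (1 - q x / a) \<le> \<rho>" if "x \<in> X" for x
  proof -
    have "(cmod (a - q x))\<^sup>2 = a\<^sup>2 - 2 * a * Re (q x) + (cmod (q x))\<^sup>2"
      unfolding cmod_power2 by (simp add: power2_eq_square algebra_simps)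
    also have "\<dots> \<le> a\<^sup>2 - 2 * a * s + R\<^sup>2"
      using s(2)[OF that] R that a by (intro add_mono diff_mono mult_left_mono power_mono) auto
    also have "\<dots> = a\<^sup>2 - R\<^sup>2"
      using s(1) by (simp add: a_def power2_eq_square)
    finally have "cmod (a - q x) \<le> sqrt (a\<^sup>2 - R\<^sup>2)"
      by (rule real_le_rsqrt)
    moreover have "1 - q x / a = (a - q x) / a"
      using a by (simp add: field_simps)
    ultimately show ?thesis
      using a by (simp add: \<rho>_def norm_divide divide_right_mono)
  qed
  have "\<rho> \<ge> 0"
    using u X(2) by (meson all_not_in_conv norm_ge_zero order_trans)
  obtain n where n: "\<rho> ^ n < e * s"
    using real_arch_pow_inv[of "e * s" \<rho>] e s(1) \<rho> by auto
  define p where "p x = (\<Sum>k<n. (1 - q x / a) ^ k) / a" for x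
  have "polynomial_Cn p"
    unfolding p_def[abs_def] by (intro polynomial_Cn_intros q)
  moreover have "cmod (1 / q x - p x) \<le> e" if x: "x \<in> X" for x
  proof -
    have qx: "q x \<noteq> 0" "s \<le> cmod (q x)"
      using s(1) s(2)[OF x] complex_Re_le_cmod[of "q x"] by auto
    have "p x = (1 - (1 - q x / a) ^ n) / q x"
      using qx(1) a by (simp add: p_def sum_gp_strict)
    then have "1 / q x - p x = (1 - q x / a) ^ n / q x"
      by (simp add: diff_divide_distrib)
    then have "cmod (1 / q x - p x) = cmod (1 - q x / a) ^ n / cmod (q x)"
      by (simp add: norm_divide norm_power)
    also have "\<dots> \<le> \<rho> ^ n / s"
      using u[OF x] qx(2) s(1) \<open>\<rho> \<ge> 0\<close> by (intro frac_le power_mono) auto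
    also have "\<dots> \<le> e"
      using n s(1) by (simp add: field_simps)
    finally show ?thesis .
  qed
  ultimately show "\<exists>p. polynomial_Cn p \<and> (\<forall>x\<in>X. cmod ((\<lambda>x\<in>X. 1 / q x) x - p x) \<le> e)"
    by (intro exI[of _ p]) auto
qed auto

section \<open>Points of the hull as multiplicative functionals\<close>

text \<open>The value at \<open>w\<close> of the functional that extends evaluation of polynomials: the unique number that
every polynomial approximating \<open>f\<close> within \<open>e\<close> on \<open>X\<close> predicts within \<open>e\<close>. Unlike
\<open>point_functional\<close>, it allows estimates directly from the definition.\<close>

definition eval_at :: "(complex ^ 'n) set \<Rightarrow> complex ^ 'n \<Rightarrow> (complex ^ 'n \<Rightarrow> complex) \<Rightarrow> complex" where
  "eval_at X w f = (THE c. \<forall>p e. polynomial_Cn p \<and> (\<forall>x\<in>X. cmod (f x - p x) \<le> e) \<longrightarrow> cmod (c - p w) \<le> e)"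

text \<open>By the definition of the hull, two polynomials that approximate \<open>f\<close> on \<open>X\<close> differ at \<open>w\<close> by at most
the sum of their errors. So the values at \<open>w\<close> of better and better approximations form a Cauchy sequence,
and its limit is the number described by \<open>eval_at\<close>.\<close>

lemma eval_at_approx:
  assumes X: "compact X" and w: "w \<in> poly_hull X" and f: "f \<in> PX X"
    and p: "polynomial_Cn p" "\<And>x. x \<in> X \<Longrightarrow> cmod (f x - p x) \<le> e"
  shows "cmod (eval_at X w f - p w) \<le> e"
proof -
  let ?L = "\<lambda>c. \<forall>p e. polynomial_Cn p \<and> (\<forall>x\<in>X. cmod (f x - p x) \<le> e) \<longrightarrow> cmod (c - p w) \<le> e"
  have X0: "X \<noteq> {}"
    using w by (simp add: poly_hull_def)
  have pq: "cmod (p w - q w) \<le> d + e"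
    if "polynomial_Cn p" "\<forall>x\<in>X. cmod (f x - p x) \<le> d"
      "polynomial_Cn q" "\<forall>x\<in>X. cmod (f x - q x) \<le> e" for p q d e
  proof (rule poly_hull_bound[OF w])
    show "cmod (p x - q x) \<le> d + e" if "x \<in> X" for x
      using norm_triangle_mono[of "f x - q x" e "p x - f x" d] that
        \<open>\<forall>x\<in>X. cmod (f x - p x) \<le> d\<close> \<open>\<forall>x\<in>X. cmod (f x - q x) \<le> e\<close>
      by (simp add: norm_minus_commute)
  qed (use that in \<open>intro polynomial_Cn_diff\<close>)
  have "\<exists>p. polynomial_Cn p \<and> (\<forall>x\<in>X. cmod (f x - p x) \<le> inverse (Suc n))" for n
    using f unfolding PX_iff[OF X X0] by simp
  then obtain P where P: "\<And>n. polynomial_Cn (P n)"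
    "\<And>n. \<forall>x\<in>X. cmod (f x - P n x) \<le> inverse (Suc n)"
    by metis
  have "Cauchy (\<lambda>n. P n w)"
  proof (rule metric_CauchyI)
    fix e :: real assume "e > 0"
    then have "eventually (\<lambda>n. inverse (Suc n) < e / 2) sequentially"
      using LIMSEQ_inverse_real_of_nat by (intro order_tendstoD) auto
    then obtain N where N: "\<And>n. n \<ge> N \<Longrightarrow> inverse (Suc n) < e / 2"
      unfolding eventually_sequentially by blast
    show "\<exists>M. \<forall>m\<ge>M. \<forall>n\<ge>M. dist (P m w) (P n w) < e"
      using pq[OF P P] N by (intro exI[of _ N]) (smt (verit) dist_norm field_sum_of_halves)
  qed
  then obtain c where c: "(\<lambda>n. P n w) \<longlonglongrightarrow> c"
    using Cauchy_convergent convergent_def by blast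
  have Lc: "?L c"
  proof (intro allI impI)
    fix p and e :: real
    assume p: "polynomial_Cn p \<and> (\<forall>x\<in>X. cmod (f x - p x) \<le> e)"
    have "(\<lambda>n. cmod (P n w - p w)) \<longlonglongrightarrow> cmod (c - p w)"
      by (intro tendsto_intros c)
    moreover have "(\<lambda>n. inverse (Suc n) + e) \<longlonglongrightarrow> 0 + e"
      by (intro tendsto_intros LIMSEQ_inverse_real_of_nat)
    ultimately show "cmod (c - p w) \<le> e"
      using pq[OF P] p by (auto intro: LIMSEQ_le)
  qed
  moreover have "d = c" if "?L d" for d
  proof -
    have "(\<lambda>n. P n w) \<longlonglongrightarrow> d"
    proof (rule metric_LIMSEQ_I)
      fix e :: real assume "e > 0"
      then have "eventually (\<lambda>n. inverse (Suc n) < e) sequentially"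
        using LIMSEQ_inverse_real_of_nat by (intro order_tendstoD) auto
      then obtain N where N: "\<And>n. n \<ge> N \<Longrightarrow> inverse (Suc n) < e"
        unfolding eventually_sequentially by blast
      then show "\<exists>N. \<forall>n\<ge>N. dist (P n w) d < e"
        using that P by (intro exI[of _ N]) (metis dist_norm norm_minus_commute order_le_less_trans)
    qed
    then show ?thesis
      using c LIMSEQ_unique by blast
  qed
  ultimately have "?L (eval_at X w f)"
    unfolding eval_at_def by (rule theI)
  then show ?thesis
    using p by blast
qed

lemma eq_if_arbitrarily_close:
  fixes a b :: complex
  assumes "\<And>e. e > 0 \<Longrightarrow> cmod (a - b) \<le> K * e"
  shows "a = b"
proof (rule ccontr)
  assume "a \<noteq> b"
  define e where "e = cmod (a - b) / (2 * (\<bar>K\<bar> + 1))"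
  have e: "e > 0"
    using \<open>a \<noteq> b\<close> by (simp add: e_def add_nonneg_pos)
  have "K * e \<le> (\<bar>K\<bar> + 1) * e"
    using e by (intro mult_right_mono) auto
  also have "\<dots> = cmod (a - b) / 2"
    by (simp add: e_def field_simps add_nonneg_eq_0_iff)
  finally have "K * e \<le> cmod (a - b) / 2" .
  moreover have "cmod (a - b) > 0"
    using \<open>a \<noteq> b\<close> by simp
  ultimately show False
    using assms[OF e] by linarith
qed

context
  fixes X :: "(complex ^ 'n) set" and w :: "complex ^ 'n"
  assumes X: "compact X" and w: "w \<in> poly_hull X"
begin

lemma poly_hull_nonempty: "X \<noteq> {}"
  using w by (simp add: poly_hull_def)

lemma PX_approx:
  assumes "f \<in> PX X" "e > 0"
  obtains p where "polynomial_Cn p" "\<And>x. x \<in> X \<Longrightarrow> cmod (f x - p x) \<le> e"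
    "cmod (eval_at X w f - p w) \<le> e"
proof -
  obtain p where p: "polynomial_Cn p" "\<forall>x\<in>X. cmod (f x - p x) \<le> e"
    using assms unfolding PX_iff[OF X poly_hull_nonempty] by blast
  then show ?thesis
    using that[of p] eval_at_approx[OF X w assms(1), of p e] by blast
qed

lemma eval_at_polynomial:
  assumes "polynomial_Cn p"
  shows "eval_at X w (restrict p X) = p w"
  using eval_at_approx[OF X w polynomial_in_PX[OF X poly_hull_nonempty assms] assms, of 0] by simp

lemma eval_at_Lipschitz:
  assumes fg: "f \<in> PX X" "g \<in> PX X" and d: "\<And>x. x \<in> X \<Longrightarrow> cmod (f x - g x) \<le> d"
  shows "cmod (eval_at X w f - eval_at X w g) \<le> d"
proof (rule field_le_epsilon)
  fix e :: real assume "e > 0"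
  then have e4: "e / 4 > 0" by simp
  obtain p where p: "polynomial_Cn p" "\<And>x. x \<in> X \<Longrightarrow> cmod (f x - p x) \<le> e / 4"
    "cmod (eval_at X w f - p w) \<le> e / 4"
    using PX_approx[OF fg(1) e4] by blast
  obtain q where q: "polynomial_Cn q" "\<And>x. x \<in> X \<Longrightarrow> cmod (g x - q x) \<le> e / 4"
    "cmod (eval_at X w g - q w) \<le> e / 4"
    using PX_approx[OF fg(2) e4] by blast
  have "cmod (p w - q w) \<le> e / 4 + d + e / 4"
  proof (rule poly_hull_bound[OF w])
    fix x assume x: "x \<in> X"
    have "p x - q x = (p x - f x) + (f x - g x) + (g x - q x)"
      by simp
    also have "cmod \<dots> \<le> e / 4 + d + e / 4"
      using p(2)[OF x] q(2)[OF x] d[OF x]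
      by (intro norm_triangle_mono) (simp_all add: norm_minus_commute)
    finally show "cmod (p x - q x) \<le> e / 4 + d + e / 4" .
  qed (intro polynomial_Cn_diff p q)
  moreover have "eval_at X w f - eval_at X w g =
      (eval_at X w f - p w) + (p w - q w) + (q w - eval_at X w g)"
    by simp
  ultimately have "cmod (eval_at X w f - eval_at X w g) \<le> e / 4 + (e / 4 + d + e / 4) + e / 4"
    using p(3) q(3) by (metis norm_minus_commute norm_triangle_mono)
  then show "cmod (eval_at X w f - eval_at X w g) \<le> d + e"
    by simp
qed

lemma eval_at_bound:
  assumes "f \<in> PX X" "\<And>x. x \<in> X \<Longrightarrow> cmod (f x) \<le> d"
  shows "cmod (eval_at X w f) \<le> d"
proof -
  have "eval_at X w (restrict (\<lambda>_. 0) X) = 0"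
    by (intro eval_at_polynomial polynomial_Cn_const)
  then show ?thesis
    using eval_at_Lipschitz[OF assms(1) polynomial_in_PX[OF X poly_hull_nonempty polynomial_Cn_const[of 0]], of d]
      assms(2) by simp
qed

lemma eval_at_add:
  assumes fg: "f \<in> PX X" "g \<in> PX X"
  shows "eval_at X w (\<lambda>x\<in>X. f x + g x) = eval_at X w f + eval_at X w g"
proof (rule eq_if_arbitrarily_close[where K = 4])
  fix e :: real assume e: "e > 0"
  obtain p where p: "polynomial_Cn p" "\<And>x. x \<in> X \<Longrightarrow> cmod (f x - p x) \<le> e"
    "cmod (eval_at X w f - p w) \<le> e"
    using PX_approx[OF fg(1) e] by blast
  obtain q where q: "polynomial_Cn q" "\<And>x. x \<in> X \<Longrightarrow> cmod (g x - q x) \<le> e"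
    "cmod (eval_at X w g - q w) \<le> e"
    using PX_approx[OF fg(2) e] by blast
  have "cmod (eval_at X w (\<lambda>x\<in>X. f x + g x) - (p w + q w)) \<le> e + e"
  proof (rule eval_at_approx[OF X w PX_add[OF X poly_hull_nonempty fg] polynomial_Cn_add[OF p(1) q(1)]])
    show "cmod ((\<lambda>x\<in>X. f x + g x) x - (p x + q x)) \<le> e + e" if "x \<in> X" for x
      using norm_triangle_mono[OF p(2)[OF that] q(2)[OF that]] that by (simp add: algebra_simps)
  qed
  moreover have "cmod ((p w + q w) - (eval_at X w f + eval_at X w g)) \<le> e + e"
    using norm_triangle_mono[OF p(3) q(3)] by (simp add: norm_minus_commute algebra_simps)
  ultimately show "cmod (eval_at X w (\<lambda>x\<in>X. f x + g x) - (eval_at X w f + eval_at X w g)) \<le> 4 * e"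
    using norm_diff_triangle_le by fastforce
qed

text \<open>Multiplicativity is proved one factor at a time, so that in each step only one factor is replaced by an
approximation.\<close>

lemma eval_at_polynomial_mult:
  assumes r: "polynomial_Cn r" and g: "g \<in> PX X"
  shows "eval_at X w (\<lambda>x\<in>X. r x * g x) = r w * eval_at X w g"
proof -
  obtain C where C: "C \<ge> 1" "\<And>x. x \<in> insert w X \<Longrightarrow> cmod (r x) \<le> C"
    using polynomial_Cn_bounded[OF r, of "insert w X"] X by auto
  have rg: "(\<lambda>x\<in>X. r x * g x) \<in> PX X"
    using PX_mult[OF X poly_hull_nonempty polynomial_in_PX[OF X poly_hull_nonempty r] g] by (simp cong: restrict_cong)
  show ?thesis
  proof (rule eq_if_arbitrarily_close[where K = "2 * C"])
    fix e :: real assume e: "e > 0"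
    obtain q where q: "polynomial_Cn q" "\<And>x. x \<in> X \<Longrightarrow> cmod (g x - q x) \<le> e"
      "cmod (eval_at X w g - q w) \<le> e"
      using PX_approx[OF g e] by blast
    have bd: "cmod (r x * a - r x * b) \<le> C * e" if "x \<in> insert w X" "cmod (a - b) \<le> e" for x a b
      unfolding right_diff_distrib[symmetric] norm_mult
      using C that e by (intro mult_mono) auto
    have "cmod (eval_at X w (\<lambda>x\<in>X. r x * g x) - r w * q w) \<le> C * e"
      by (rule eval_at_approx[OF X w rg polynomial_Cn_mult[OF r q(1)]]) (use bd q(2) in auto)
    moreover have "cmod (r w * q w - r w * eval_at X w g) \<le> C * e"
      by (intro bd) (use q(3) in \<open>auto simp: norm_minus_commute\<close>)
    ultimately show "cmod (eval_at X w (\<lambda>x\<in>X. r x * g x) - r w * eval_at X w g) \<le> 2 * C * e"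
      using norm_diff_triangle_le by fastforce
  qed
qed

lemma eval_at_mult:
  assumes f: "f \<in> PX X" and g: "g \<in> PX X"
  shows "eval_at X w (\<lambda>x\<in>X. f x * g x) = eval_at X w f * eval_at X w g"
proof -
  obtain B where B: "B \<ge> 1" "\<And>x. x \<in> X \<Longrightarrow> cmod (g x) \<le> B"
    using PX_bounded[OF X g] by blast
  show ?thesis
  proof (rule eq_if_arbitrarily_close[where K = "2 * B"])
    fix e :: real assume e: "e > 0"
    obtain p where p: "polynomial_Cn p" "\<And>x. x \<in> X \<Longrightarrow> cmod (f x - p x) \<le> e"
      "cmod (eval_at X w f - p w) \<le> e"
      using PX_approx[OF f e] by blast
    have bd: "cmod (a * c - b * c) \<le> e * B" if "cmod (a - b) \<le> e" "cmod c \<le> B" for a b c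
      unfolding left_diff_distrib[symmetric] norm_mult
      using that e by (intro mult_mono) auto
    have pg: "(\<lambda>x\<in>X. p x * g x) \<in> PX X"
      using PX_mult[OF X poly_hull_nonempty polynomial_in_PX[OF X poly_hull_nonempty p(1)] g] by (simp cong: restrict_cong)
    have "cmod (eval_at X w (\<lambda>x\<in>X. f x * g x) - eval_at X w (\<lambda>x\<in>X. p x * g x)) \<le> e * B"
      by (rule eval_at_Lipschitz[OF PX_mult[OF X poly_hull_nonempty f g] pg]) (use bd p(2) B(2) in auto)
    moreover have "cmod (p w * eval_at X w g - eval_at X w f * eval_at X w g) \<le> e * B"
      by (intro bd eval_at_bound g B) (use p(3) in \<open>auto simp: norm_minus_commute\<close>)
    ultimately have "cmod (eval_at X w (\<lambda>x\<in>X. f x * g x) - eval_at X w f * eval_at X w g)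
        \<le> e * B + e * B"
      unfolding eval_at_polynomial_mult[OF p(1) g] by (rule norm_diff_triangle_le)
    then show "cmod (eval_at X w (\<lambda>x\<in>X. f x * g x) - eval_at X w f * eval_at X w g) \<le> 2 * B * e"
      by simp
  qed
qed

lemma eval_at_cmult:
  assumes "f \<in> PX X"
  shows "eval_at X w (\<lambda>x\<in>X. c * f x) = c * eval_at X w f"
  using eval_at_polynomial_mult[OF polynomial_Cn_const[of c] assms] .

text \<open>Existence: \<open>eval_at\<close> is 1-Lipschitz and multiplicative. Uniqueness: continuous functionals that agree on
polynomials agree on their closure.\<close>

lemma point_functional_eq_eval_at:
  assumes "f \<in> PX X"
  shows "point_functional X w f = eval_at X w f"
proof -
  let ?\<phi> = "restrict (eval_at X w) (PX X)"
  let ?P = "\<lambda>\<phi>. \<phi> \<in> extensional (PX X) \<and> mult_functional X \<phi> \<and>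
    (\<forall>p. polynomial_Cn p \<longrightarrow> \<phi> (restrict p X) = p w)"
  have "Lipschitz_continuous_map (submetric (C_metric X) (PX X)) euclidean_metric ?\<phi>"
    unfolding Lipschitz_continuous_map_def
  proof (intro conjI exI[of _ 1] ballI)
    fix f g assume "f \<in> mspace (submetric (C_metric X) (PX X))" "g \<in> mspace (submetric (C_metric X) (PX X))"
    then have fg: "f \<in> PX X" "g \<in> PX X" "f \<in> mspace (C_metric X)" "g \<in> mspace (C_metric X)"
      by (simp_all only: mspace_submetric Int_iff)
    have "cmod (f x - g x) \<le> mdist (C_metric X) f g" if "x \<in> X" for x
      using C_metric_mdist_le[OF fg(3,4) poly_hull_nonempty, of "mdist (C_metric X) f g"] that by blast
    then have "cmod (eval_at X w f - eval_at X w g) \<le> mdist (C_metric X) f g"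
      by (rule eval_at_Lipschitz[OF fg(1,2)])
    then show "mdist euclidean_metric (?\<phi> f) (?\<phi> g) \<le> 1 * mdist (submetric (C_metric X) (PX X)) f g"
      using fg(1,2) by (simp add: dist_norm)
  qed auto
  then have cont: "continuous_map (subtopology (mtopology_of (C_metric X)) (PX X)) euclidean ?\<phi>"
    by (metis Lipschitz_continuous_imp_continuous_map mtopology_of_euclidean mtopology_of_submetric)
  have "mult_functional X ?\<phi>"
    unfolding mult_functional_def
  proof (intro conjI ballI allI cont)
    fix f g assume fg: "f \<in> PX X" "g \<in> PX X"
    show "?\<phi> (\<lambda>x\<in>X. f x + g x) = ?\<phi> f + ?\<phi> g"
      using fg PX_add[OF X poly_hull_nonempty fg] eval_at_add[OF fg] by simp
    show "?\<phi> (\<lambda>x\<in>X. f x * g x) = ?\<phi> f * ?\<phi> g"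
      using fg PX_mult[OF X poly_hull_nonempty fg] eval_at_mult[OF fg] by simp
  next
    fix c f assume f: "f \<in> PX X"
    show "?\<phi> (\<lambda>x\<in>X. c * f x) = c * ?\<phi> f"
      using f PX_cmult[OF X poly_hull_nonempty f] eval_at_cmult[OF f] by simp
  qed
  then have P: "?P ?\<phi>"
    using polynomial_in_PX[OF X poly_hull_nonempty] eval_at_polynomial by simp
  have "\<psi> = ?\<phi>" if \<psi>: "?P \<psi>" for \<psi>
  proof (rule extensionalityI[where A = "PX X"])
    fix f assume f: "f \<in> PX X"
    let ?S = "{restrict p X | p. polynomial_Cn p}"
    have "?S \<subseteq> PX X"
      using polynomial_in_PX[OF X poly_hull_nonempty] by blast
    then have "f \<in> subtopology (mtopology_of (C_metric X)) (PX X) closure_of ?S"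
      using f by (simp add: closure_of_subtopology PX_def Int_absorb1)
    moreover have "continuous_map (subtopology (mtopology_of (C_metric X)) (PX X)) euclidean \<psi>"
      using \<psi> by (simp add: mult_functional_def)
    moreover have "\<psi> g = ?\<phi> g" if "g \<in> ?S" for g
      using that \<psi> P by auto
    ultimately show "\<psi> f = ?\<phi> f"
      using forall_in_closure_of_eq[OF _ Hausdorff_space_euclidean _ cont] by blast
  qed (use \<psi> P in auto)
  then have "point_functional X w = ?\<phi>"
    unfolding point_functional_def using P by (intro the_equality) blast+
  then show ?thesis
    using assms by simp
qed

end

lemma eval_at_inverse:
  assumes X: "compact X" and w: "w \<in> poly_hull X" and q: "polynomial_Cn q"
    and s: "s > 0" "\<And>x. x \<in> X \<Longrightarrow> s \<le> Re (q x)"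
  shows "q w * eval_at X w (\<lambda>x\<in>X. 1 / q x) = 1"
proof -
  have "X \<noteq> {}"
    using w by (simp add: poly_hull_def)
  have "q x \<noteq> 0" if "x \<in> X" for x
    using s(1) s(2)[OF that] by auto
  then have one: "(\<lambda>x\<in>X. q x * (\<lambda>x\<in>X. 1 / q x) x) = (\<lambda>x\<in>X. 1)"
    by (intro restrict_ext) simp
  have "q w * eval_at X w (\<lambda>x\<in>X. 1 / q x) = eval_at X w (\<lambda>x\<in>X. q x * (\<lambda>x\<in>X. 1 / q x) x)"
    by (rule eval_at_polynomial_mult[OF X w q PX_inverse_of_polynomial[OF X \<open>X \<noteq> {}\<close> q s], symmetric])
  also have "\<dots> = 1"
    unfolding one by (rule eval_at_polynomial[OF X w polynomial_Cn_const])
  finally show ?thesis .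
qed

text \<open>A lower bound for the modulus passes from \<open>X\<close> to the hull as an upper bound for the inverse function,
which is available in \<open>P(X)\<close> because of the half-plane hypothesis; a bound \<open>s \<le> |q|\<close> on \<open>X\<close> alone
would not pass to the hull.\<close>

lemma poly_hull_ge_norm_if_Re_ge:
  assumes X: "compact X" and w: "w \<in> poly_hull X" and q: "polynomial_Cn q"
    and s: "s > 0" "\<And>x. x \<in> X \<Longrightarrow> s \<le> Re (q x)"
  shows "s \<le> cmod (q w)"
proof -
  have "X \<noteq> {}"
    using w by (simp add: poly_hull_def)
  have "cmod ((\<lambda>x\<in>X. 1 / q x) x) \<le> 1 / s" if "x \<in> X" for x
    using that s(1) s(2)[OF that] complex_Re_le_cmod[of "q x"]
    by (simp add: norm_divide frac_le)
  then have "cmod (eval_at X w (\<lambda>x\<in>X. 1 / q x)) \<le> 1 / s"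
    using eval_at_bound[OF X w PX_inverse_of_polynomial[OF X \<open>X \<noteq> {}\<close> q s]] by blast
  then have "cmod (q w) * cmod (eval_at X w (\<lambda>x\<in>X. 1 / q x)) \<le> cmod (q w) * (1 / s)"
    by (intro mult_left_mono) auto
  moreover have "cmod (q w) * cmod (eval_at X w (\<lambda>x\<in>X. 1 / q x)) = 1"
    using arg_cong[OF eval_at_inverse[OF X w q s], of cmod] by (simp only: norm_mult norm_one)
  ultimately have "1 \<le> cmod (q w) * (1 / s)"
    by simp
  then show ?thesis
    using s(1) by (simp add: field_simps)
qed

section \<open>Criteria for one-point Gleason parts and dense invertibles\<close>

text \<open>The supremum that defines \<open>dual_dist\<close> is over a set bounded above by \<open>2\<close>, since each functional is
bounded by the supremum norm.\<close>

lemma dual_dist_ge: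
  assumes X: "compact X" and w: "w \<in> poly_hull X" and z: "z \<in> poly_hull X"
    and f: "f \<in> PX X" "\<And>x. x \<in> X \<Longrightarrow> cmod (f x) \<le> 1"
  shows "cmod (eval_at X z f - eval_at X w f) \<le> dual_dist X z w"
proof -
  have "X \<noteq> {}"
    using w by (simp add: poly_hull_def)
  let ?B = "{f \<in> PX X. sup_norm X f \<le> 1}"
  have le1: "cmod (eval_at X u g) \<le> 1" if "g \<in> ?B" "u \<in> poly_hull X" for g u
  proof (rule eval_at_bound[OF X that(2)])
    show "g \<in> PX X" using that(1) by simp
    obtain B where "B \<ge> 1" "\<And>x. x \<in> X \<Longrightarrow> cmod (g x) \<le> B"
      using PX_bounded[OF X \<open>g \<in> PX X\<close>] by blast
    then have "bdd_above ((\<lambda>x. cmod (g x)) ` X)"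
      by (auto simp: bdd_above_def)
    then show "cmod (g x) \<le> 1" if "x \<in> X" for x
      using cSUP_upper[OF that, of "\<lambda>x. cmod (g x)"] \<open>g \<in> ?B\<close> by (simp add: sup_norm_def)
  qed
  have "bdd_above ((\<lambda>f. cmod (point_functional X z f - point_functional X w f)) ` ?B)"
  proof (rule bdd_aboveI2)
    fix g assume g: "g \<in> ?B"
    show "cmod (point_functional X z g - point_functional X w g) \<le> 2"
      using norm_triangle_ineq4[of "eval_at X z g" "eval_at X w g"] le1[OF g z] le1[OF g w] g
      by (simp add: point_functional_eq_eval_at[OF X z] point_functional_eq_eval_at[OF X w])
  qed
  moreover have "f \<in> ?B"
    using f \<open>X \<noteq> {}\<close> by (auto simp: sup_norm_def intro: cSUP_least)
  ultimately show ?thesis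
    unfolding dual_dist_def
    using cSUP_upper[of f ?B "\<lambda>f. cmod (point_functional X z f - point_functional X w f)"] f(1)
    by (simp add: point_functional_eq_eval_at[OF X z] point_functional_eq_eval_at[OF X w])
qed

lemma dual_dist_self:
  assumes X: "compact X" "X \<noteq> {}"
  shows "dual_dist X z z = 0"
proof -
  have "restrict (\<lambda>_. 0) X \<in> {f \<in> PX X. sup_norm X f \<le> 1}"
    using polynomial_in_PX[OF X polynomial_Cn_const[of 0]] X(2)
    by (auto simp: sup_norm_def intro!: cSUP_least)
  then have "{f \<in> PX X. sup_norm X f \<le> 1} \<noteq> {}"
    by blast
  then show ?thesis
    unfolding dual_dist_def by simp
qed

lemma norm_Cayley_le_1:
  fixes h :: complex
  assumes "a > 0" "Re h \<ge> 0"
  shows "cmod ((of_real a - h) / (of_real a + h)) \<le> 1"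
proof -
  have "(cmod (of_real a - h))\<^sup>2 \<le> (cmod (of_real a + h))\<^sup>2"
    unfolding cmod_power2 using assms by (simp add: power2_eq_square algebra_simps)
  then have "cmod (of_real a - h) \<le> cmod (of_real a + h)"
    by (rule power2_le_imp_le) simp
  moreover have "cmod (of_real a + h) > 0"
    using assms by (auto simp: complex_eq_iff)
  ultimately show ?thesis
    by (simp add: norm_divide)
qed

text \<open>The Cayley transform \<open>(a - h) / (a + h)\<close> maps the right half-plane into the unit disc. With
\<open>a = sqrt |h w|\<close>, the geometric mean of \<open>|h z| = 1\<close> and \<open>|h w|\<close>, it sends \<open>h z\<close> close to \<open>1\<close> and
\<open>h w\<close> close to \<open>-1\<close> once \<open>a\<close> is large.\<close>

lemma dual_dist_ge_if_Re_nonneg: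
  assumes X: "compact X" and w: "w \<in> poly_hull X" and z: "z \<in> poly_hull X"
    and h: "polynomial_Cn h" "\<And>x. x \<in> X \<Longrightarrow> 0 \<le> Re (h x)" "h z = 1" "cmod (h w) = a\<^sup>2"
    and a: "a > 1"
  shows "2 - 4 / (a - 1) \<le> dual_dist X z w"
proof -
  have X0: "X \<noteq> {}"
    using w by (simp add: poly_hull_def)
  define q where "q x = of_real a + h x" for x
  have q: "polynomial_Cn q" "polynomial_Cn (\<lambda>x. of_real a - h x)"
    unfolding q_def[abs_def] by (intro polynomial_Cn_intros h)+
  have Req: "1 \<le> Re (q x)" if "x \<in> X" for x
    using h(2)[OF that] a by (simp add: q_def)
  define g where "g = (\<lambda>x\<in>X. 1 / q x)"
  have g: "g \<in> PX X"
    unfolding g_def using PX_inverse_of_polynomial[OF X X0 q(1) _ Req] by simp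
  define f where "f = (\<lambda>x\<in>X. (of_real a - h x) * g x)"
  have "f = (\<lambda>x\<in>X. restrict (\<lambda>x. of_real a - h x) X x * g x)"
    by (auto simp: f_def)
  then have f: "f \<in> PX X"
    using PX_mult[OF X X0 polynomial_in_PX[OF X X0 q(2)] g] by simp
  have "cmod (f x) \<le> 1" if "x \<in> X" for x
    using norm_Cayley_le_1[of a "h x"] a h(2)[OF that] that by (simp add: f_def g_def q_def)
  then have le: "cmod (eval_at X z f - eval_at X w f) \<le> dual_dist X z w"
    by (intro dual_dist_ge X w z f)
  have ev: "q u \<noteq> 0 \<and> eval_at X u f = 2 * of_real a / q u - 1" if "u \<in> poly_hull X" for u
  proof -
    have 1: "q u * eval_at X u g = 1"
      unfolding g_def by (rule eval_at_inverse[OF X that q(1) zero_less_one Req])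
    then have "q u \<noteq> 0"
      by auto
    with 1 have "eval_at X u g = 1 / q u"
      by (simp add: field_simps)
    then have "eval_at X u f = (of_real a - h u) / q u"
      unfolding f_def by (simp add: eval_at_polynomial_mult[OF X that q(2) g])
    then show ?thesis
      using \<open>q u \<noteq> 0\<close> by (simp add: q_def field_simps)
  qed
  have "eval_at X z f - eval_at X w f = of_real (2 * a / (a + 1)) - 2 * of_real a / q w"
    using ev[OF z] ev[OF w] h(3) by (simp add: q_def)
  then have "cmod (of_real (2 * a / (a + 1))) - cmod (2 * of_real a / q w) \<le> dual_dist X z w"
    using le norm_triangle_ineq2[of "of_real (2 * a / (a + 1)) :: complex" "2 * of_real a / q w"] by simp
  moreover have "cmod (of_real (2 * a / (a + 1))) = 2 * a / (a + 1)"
    unfolding norm_of_real using a by simp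
  moreover have "2 - 2 / (a - 1) \<le> 2 * a / (a + 1)"
  proof -
    have "2 * a / (a + 1) = 2 - 2 / (a + 1)"
      using a by (simp add: field_simps)
    moreover have "2 / (a + 1) \<le> 2 / (a - 1)"
      using a by (intro divide_left_mono) auto
    ultimately show ?thesis by linarith
  qed
  moreover have "cmod (2 * of_real a / q w) \<le> 2 / (a - 1)"
  proof -
    have "a * (a - 1) \<le> cmod (q w)"
      using norm_triangle_ineq2[of "h w" "- of_real a"] h(4) a
      by (simp add: q_def power2_eq_square algebra_simps)
    moreover have pos: "0 < a * (a - 1)"
      using a by simp
    moreover have "0 < cmod (q w)"
      using pos calculation(1) by (rule order_less_le_trans)
    ultimately have "2 * a / cmod (q w) \<le> 2 * a / (a * (a - 1))"
      using a by (intro divide_left_mono mult_pos_pos[of "cmod (q w)"]) simp_all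
    then show ?thesis
      using a by (simp add: norm_divide norm_mult)
  qed
  ultimately show ?thesis
    by linarith
qed

text \<open>Functions with nonnegative real part and value \<open>1\<close> at \<open>z\<close> satisfy a Harnack bound at the points of the
Gleason part of \<open>z\<close>; so a point where they are unbounded is in another part.\<close>

lemma one_point_gleason_partI:
  fixes z :: "complex ^ 'n"
  assumes X: "compact X" and z: "z \<in> poly_hull X"
    and far: "\<And>w C. w \<in> poly_hull X \<Longrightarrow> w \<noteq> z \<Longrightarrow>
      \<exists>h. polynomial_Cn h \<and> (\<forall>x\<in>X. 0 \<le> Re (h x)) \<and> h z = 1 \<and> C \<le> cmod (h w)"
  shows "one_point_gleason_part X z"
proof -
  have X0: "X \<noteq> {}"
    using z by (simp add: poly_hull_def)
  have "2 \<le> dual_dist X z w" if w: "w \<in> poly_hull X" "w \<noteq> z" for w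
  proof (rule field_le_epsilon)
    fix e :: real assume "e > 0"
    obtain h where h: "polynomial_Cn h" "\<And>x. x \<in> X \<Longrightarrow> 0 \<le> Re (h x)" "h z = 1"
      "(1 + 4 / e)\<^sup>2 \<le> cmod (h w)"
      using far[OF w] by blast
    define a where "a = sqrt (cmod (h w))"
    have a: "1 + 4 / e \<le> a"
      using h(4) by (simp add: a_def real_le_rsqrt)
    have "4 / e > 0"
      using \<open>e > 0\<close> by simp
    then have "a > 1"
      using a by linarith
    moreover have "cmod (h w) = a\<^sup>2"
      by (simp add: a_def)
    ultimately have "2 - 4 / (a - 1) \<le> dual_dist X z w"
      by (intro dual_dist_ge_if_Re_nonneg[OF X w(1) z h(1-3)])
    moreover have "4 / (a - 1) \<le> 4 / (4 / e)"
      using a \<open>4 / e > 0\<close> \<open>a > 1\<close> by (intro divide_left_mono mult_pos_pos) simp_all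
    ultimately show "2 \<le> dual_dist X z w + e"
      by simp
  qed
  then have "w = z" if "w \<in> poly_hull X" "dual_dist X z w < 2" for w
    using that by (meson not_less)
  then have "gleason_rel X `` {z} = {z}"
    using z dual_dist_self[OF X X0, of z] by (auto simp: gleason_rel_def)
  moreover have "gleason_rel X `` {z} \<in> poly_hull X // gleason_rel X"
    by (rule quotientI[OF z])
  ultimately show ?thesis
    unfolding one_point_gleason_part_def gleason_parts_def by simp
qed

lemma dense_invertiblesI:
  assumes X: "compact X" "X \<noteq> {}"
    and dense: "\<And>p e. polynomial_Cn p \<Longrightarrow> e > 0 \<Longrightarrow>
      \<exists>q. invertible_in_PX X (restrict q X) \<and> (\<forall>x\<in>X. cmod (p x - q x) \<le> e)"
  shows "dense_invertibles X"
  unfolding dense_invertibles_def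
proof
  fix f assume f: "f \<in> PX X"
  have T: "{f. invertible_in_PX X f} \<subseteq> mspace (C_metric X)"
    by (rule order_trans[OF _ PX_subset_C_metric]) (simp add: invertible_in_PX_def subset_iff)
  show "f \<in> mtopology_of (C_metric X) closure_of {f. invertible_in_PX X f}"
    unfolding C_metric_closure_of[OF X(2) T]
  proof (intro conjI allI impI)
    show "f \<in> mspace (C_metric X)"
      by (rule subsetD[OF PX_subset_C_metric f])
    fix e :: real assume "e > 0"
    then have e2: "e / 2 > 0" by simp
    then obtain p where p: "polynomial_Cn p" "\<forall>x\<in>X. cmod (f x - p x) \<le> e / 2"
      using f PX_iff[OF X, of f] by meson
    obtain q where q: "invertible_in_PX X (restrict q X)" "\<forall>x\<in>X. cmod (p x - q x) \<le> e / 2"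
      using dense[OF p(1) e2] by blast
    have "cmod (f x - restrict q X x) \<le> e" if "x \<in> X" for x
      using norm_diff_triangle_le[of "f x" "p x" "e / 2" "q x" "e / 2"] p(2) q(2) that by simp
    then show "\<exists>g\<in>{f. invertible_in_PX X f}. \<forall>x\<in>X. cmod (f x - g x) \<le> e"
      using q(1) by (intro bexI[of _ "restrict q X"] ballI) simp_all
  qed
qed

section \<open>The tower of polynomials\<close>

text \<open>The point \<open>1\<close> is on the circle of radius \<open>1 + c\<close> about \<open>-c\<close>. When \<open>c\<close> is large compared with \<open>R\<^sup>2\<close>,
the truncated half-plane \<open>|t| \<le> R\<close>, \<open>Re t < 1/2\<close> is in a strictly smaller concentric disc, so a high
power of \<open>(t + c) / (1 + c)\<close> is \<open>1\<close> at \<open>1\<close> and tiny there. The exponent \<open>M\<close> is chosen just large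
enough to beat \<open>K\<close>: this gives the last conclusion, in which neither \<open>R\<close> nor \<open>c\<close> occurs.\<close>

lemma damping_factor:
  fixes p Q :: "complex ^ 'n \<Rightarrow> complex"
  assumes S: "compact S" and Q: "polynomial_Cn Q" "Q x0 = 1"
    and K: "K \<ge> 1" "\<forall>x\<in>S. cmod (p x) \<le> K"
  obtains g where "polynomial_Cn g" "g x0 = 1"
    "\<And>x. x \<in> S \<Longrightarrow> Re (Q x) < 1 / 2 \<Longrightarrow> cmod (p x * g x) \<le> 1 / 4"
    "\<And>z C. cmod (Q z) \<le> C \<Longrightarrow> cmod (g z) \<le> exp ((4 * ln (4 * K) + 1) * C)"
proof -
  obtain R where R: "R \<ge> 1" "\<And>x. x \<in> S \<Longrightarrow> cmod (Q x) \<le> R"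
    using polynomial_Cn_bounded[OF Q(1) S] by blast
  define c where "c = 2 * R\<^sup>2"
  define L where "L = 4 * ln (4 * K)"
  define M where "M = nat \<lceil>L * (1 + c)\<rceil>"
  define g where "g z = ((Q z + of_real c) / of_real (1 + c)) ^ M" for z
  have c: "c > 0"
    using R(1) by (simp add: c_def)
  have L: "L \<ge> 0"
    using K(1) by (simp add: L_def)
  have norm1c: "cmod (of_real (1 + c)) = 1 + c"
    unfolding norm_of_real using c by simp
  have M_lower: "L \<le> real M / (1 + c)"
    using c real_nat_ceiling_ge[of "L * (1 + c)"] by (simp add: M_def pos_le_divide_eq)
  have M_upper: "real M / (1 + c) \<le> L + 1"
  proof -
    have "real M \<le> L * (1 + c) + 1"
      using L c unfolding M_def by (simp add: of_nat_ceiling le_of_int_ceiling)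
    also have "\<dots> \<le> (L + 1) * (1 + c)"
      using c by (simp add: algebra_simps)
    finally show ?thesis
      using c by (simp add: pos_divide_le_eq)
  qed
  show ?thesis
  proof (rule that[of g])
    show "polynomial_Cn g"
      unfolding g_def[abs_def] by (intro polynomial_Cn_intros Q)
    have "1 + complex_of_real c \<noteq> 0"
      using c norm1c by auto
    then show "g x0 = 1"
      by (simp add: g_def Q(2))
  next
    \<comment> \<open>The squared modulus gains a factor \<open>1 - 1 / (2 (1 + c))\<close>, because \<open>R\<^sup>2 = c / 2\<close>.\<close>
    fix x assume x: "x \<in> S" "Re (Q x) < 1 / 2"
    have "(cmod (Q x + of_real c))\<^sup>2 = (cmod (Q x))\<^sup>2 + 2 * c * Re (Q x) + c\<^sup>2"
      unfolding cmod_power2 by (simp add: power2_eq_square algebra_simps)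
    also have "\<dots> \<le> R\<^sup>2 + 2 * c * (1 / 2) + c\<^sup>2"
      using R(2)[OF x(1)] x(2) c by (intro add_mono mult_left_mono power_mono) auto
    also have "\<dots> \<le> (1 - 1 / (2 * (1 + c))) * (1 + c)\<^sup>2"
    proof -
      have eq: "(1 - 1 / (2 * (1 + c))) * (1 + c)\<^sup>2 = (1 + c)\<^sup>2 - (1 + c) / 2"
        using c by (simp add: field_simps power2_eq_square)
      have R2: "R\<^sup>2 = c / 2"
        by (simp add: c_def)
      show ?thesis
        unfolding eq R2 by (simp add: power2_eq_square field_simps)
    qed
    also have "\<dots> \<le> exp (- 1 / (2 * (1 + c))) * (1 + c)\<^sup>2"
      using exp_ge_add_one_self[of "- 1 / (2 * (1 + c))"] by (intro mult_right_mono) auto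
    also have "\<dots> = (exp (- 1 / (4 * (1 + c))) * (1 + c))\<^sup>2"
    proof -
      have "- 1 / (2 * (1 + c)) = 2 * (- 1 / (4 * (1 + c)))"
        using c by (simp add: divide_simps)
      then show ?thesis
        by (simp only: exp_double power_mult_distrib)
    qed
    finally have "cmod (Q x + of_real c) \<le> exp (- 1 / (4 * (1 + c))) * (1 + c)"
      by (rule power2_le_imp_le) (use c in auto)
    then have "cmod ((Q x + of_real c) / of_real (1 + c)) \<le> exp (- 1 / (4 * (1 + c)))"
      unfolding norm_divide norm1c using c by (simp add: pos_divide_le_eq)
    then have "cmod (g x) \<le> exp (- 1 / (4 * (1 + c))) ^ M"
      unfolding g_def norm_power by (intro power_mono) auto
    also have "\<dots> = exp (- (real M / (1 + c)) / 4)"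
      by (simp flip: exp_of_nat_mult)
    also have "\<dots> \<le> exp (- L / 4)"
      unfolding exp_le_cancel_iff using M_lower by (intro divide_right_mono) simp_all
    also have "\<dots> = 1 / (4 * K)"
      using K(1) by (simp add: L_def exp_minus field_simps)
    finally have "cmod (p x * g x) \<le> K * (1 / (4 * K))"
      unfolding norm_mult using K x(1) by (intro mult_mono) auto
    then show "cmod (p x * g x) \<le> 1 / 4"
      using K(1) by simp
  next
    fix z C assume C: "cmod (Q z) \<le> C"
    then have C0: "0 \<le> C"
      using norm_ge_zero order_trans by blast
    have "cmod (Q z + of_real c) \<le> C + c"
      using norm_triangle_mono[OF C, of "of_real c" c] c by simp
    then have "cmod ((Q z + of_real c) / of_real (1 + c)) \<le> (C + c) / (1 + c)"
      unfolding norm_divide norm1c using c by (intro divide_right_mono) auto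
    also have "\<dots> \<le> 1 + C / (1 + c)"
      using c by (simp add: field_simps)
    also have "\<dots> \<le> exp (C / (1 + c))"
      by (rule exp_ge_add_one_self)
    finally have "cmod (g z) \<le> exp (C / (1 + c)) ^ M"
      unfolding g_def norm_power by (intro power_mono) auto
    also have "\<dots> = exp (real M / (1 + c) * C)"
      by (simp flip: exp_of_nat_mult)
    also have "\<dots> \<le> exp ((L + 1) * C)"
      unfolding exp_le_cancel_iff by (rule mult_right_mono[OF M_upper C0])
    finally show "cmod (g z) \<le> exp ((4 * ln (4 * K) + 1) * C)"
      by (simp add: L_def)
  qed
qed

lemma polynomial_tower:
  fixes p :: "nat \<Rightarrow> complex ^ 'n \<Rightarrow> complex"
  assumes S: "compact S" and p: "\<And>n. polynomial_Cn (p n)" "\<And>n. p n x0 = 1"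
    and K: "\<And>n. K n \<ge> 1" "\<And>n. \<forall>x\<in>S. cmod (p n x) \<le> K n"
  obtains Q g where "\<And>n. polynomial_Cn (Q n)" "\<And>n. Q n x0 = 1" "\<And>n. polynomial_Cn (g n)"
    "\<And>n z. Q (Suc n) z = p n z * g n z"
    "\<And>n x. x \<in> S \<Longrightarrow> Re (Q n x) < 1 / 2 \<Longrightarrow> cmod (Q (Suc n) x) \<le> 1 / 4"
    "\<And>n z C. cmod (Q n z) \<le> C \<Longrightarrow> cmod (g n z) \<le> exp ((4 * ln (4 * K n) + 1) * C)"
proof -
  let ?P = "\<lambda>(n :: nat) Q. polynomial_Cn Q \<and> Q x0 = 1"
  let ?R = "\<lambda>n Q Q'. \<exists>g. polynomial_Cn g \<and> (\<forall>z. Q' z = p n z * g z) \<and>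
    (\<forall>x\<in>S. Re (Q x) < 1 / 2 \<longrightarrow> cmod (Q' x) \<le> 1 / 4) \<and>
    (\<forall>z C. cmod (Q z) \<le> C \<longrightarrow> cmod (g z) \<le> exp ((4 * ln (4 * K n) + 1) * C))"
  have "\<exists>Q. \<forall>n. ?P n (Q n) \<and> ?R n (Q n) (Q (Suc n))"
  proof (rule dependent_nat_choice)
    show "\<exists>Q. ?P 0 Q"
      by (intro exI[of _ "\<lambda>_. 1"]) (simp add: polynomial_Cn_const)
  next
    fix Q n assume "?P n Q"
    then have Q: "polynomial_Cn Q" "Q x0 = 1" by auto
    obtain g where g: "polynomial_Cn g" "g x0 = 1"
      "\<And>x. x \<in> S \<Longrightarrow> Re (Q x) < 1 / 2 \<Longrightarrow> cmod (p n x * g x) \<le> 1 / 4"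
      "\<And>z C. cmod (Q z) \<le> C \<Longrightarrow> cmod (g z) \<le> exp ((4 * ln (4 * K n) + 1) * C)"
      using damping_factor[OF S Q K(1)[of n] K(2)[of n]] by blast
    show "\<exists>Q'. ?P (Suc n) Q' \<and> ?R n Q Q'"
      using g p by (intro exI[of _ "\<lambda>z. p n z * g z"] conjI exI[of _ g])
        (auto intro: polynomial_Cn_mult)
  qed
  then obtain Q where Q: "\<And>n. ?P n (Q n)" "\<And>n. ?R n (Q n) (Q (Suc n))"
    by blast
  from Q(2) obtain g where "\<And>n. polynomial_Cn (g n) \<and> (\<forall>z. Q (Suc n) z = p n z * g n z) \<and>
    (\<forall>x\<in>S. Re (Q n x) < 1 / 2 \<longrightarrow> cmod (Q (Suc n) x) \<le> 1 / 4) \<and>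
    (\<forall>z C. cmod (Q n z) \<le> C \<longrightarrow> cmod (g n z) \<le> exp ((4 * ln (4 * K n) + 1) * C))"
    by metis
  then show ?thesis
    using Q(1) by (intro that[of Q g]) blast+
qed

text \<open>Dividing a countable dense family by its values at \<open>x0\<close> keeps density up to scalars. The last
conclusion comes from approximating an affine function that is \<open>1\<close> at \<open>x0\<close> and \<open>0\<close> at \<open>w\<close>: its
normalized approximations tend to \<open>0\<close> at \<open>w\<close> and stay uniformly bounded on \<open>T\<close>.\<close>

lemma normalized_dense_polynomials:
  fixes x0 :: "complex ^ 'n"
  obtains p :: "nat \<Rightarrow> complex ^ 'n \<Rightarrow> complex"
  where "\<And>n. polynomial_Cn (p n)" "\<And>n. p n x0 = 1"
    "\<And>f T e. \<lbrakk>polynomial_Cn f; compact T; e > 0\<rbrakk> \<Longrightarrow>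
       \<exists>n c. c \<noteq> 0 \<and> (\<forall>x\<in>T. cmod (f x - c * p n x) \<le> e)"
    "\<And>w T. \<lbrakk>w \<noteq> x0; compact T\<rbrakk> \<Longrightarrow>
       \<exists>K\<ge>1. \<forall>e>0. \<exists>n. cmod (p n w) \<le> e \<and> (\<forall>x\<in>T. cmod (p n x) \<le> K)"
proof -
  obtain D :: "(complex ^ 'n \<Rightarrow> complex) set"
    where D: "countable D" "\<And>r. r \<in> D \<Longrightarrow> polynomial_Cn r"
    and dense: "\<And>p T e. \<lbrakk>polynomial_Cn p; compact T; e > 0\<rbrakk> \<Longrightarrow> \<exists>r\<in>D. \<forall>x\<in>T. cmod (p x - r x) \<le> e"
    using countable_dense_polynomials by blast
  define F where "F = (\<lambda>r z. r z / r x0) ` {r \<in> D. r x0 \<noteq> 0}"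
  define p where "p = from_nat_into F"
  have "\<exists>r\<in>D. \<forall>x\<in>{x0}. cmod (1 - r x) \<le> 1 / 2"
    by (intro dense polynomial_Cn_const) auto
  then obtain r0 where "r0 \<in> D" "cmod (1 - r0 x0) \<le> 1 / 2" by blast
  then have F0: "F \<noteq> {}"
    unfolding F_def by force
  have p_in: "p n \<in> F" for n
    unfolding p_def by (rule from_nat_into[OF F0])
  have "countable F"
    unfolding F_def using D(1) by (intro countable_image countable_subset[OF _ D(1)]) auto
  then have surj: "\<exists>n. p n = (\<lambda>z. r z / r x0)" if "r \<in> D" "r x0 \<noteq> 0" for r
    using from_nat_into_surj[of F "\<lambda>z. r z / r x0"] that unfolding p_def F_def by blast
  show ?thesis
  proof (rule that[of p])
    fix n
    obtain r where r: "r \<in> D" "r x0 \<noteq> 0" "p n = (\<lambda>z. r z / r x0)"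
      using p_in[of n] by (auto simp: F_def)
    show "polynomial_Cn (p n)" "p n x0 = 1"
      unfolding r(3) using r(2) by (intro polynomial_Cn_divide D(2) r(1), simp)
  next
    fix f :: "complex ^ 'n \<Rightarrow> complex" and T :: "(complex ^ 'n) set" and e :: real
    assume f: "polynomial_Cn f" and T: "compact T" and e: "e > 0"
    \<comment> \<open>The shift \<open>\<delta>\<close> moves the value at \<open>x0\<close> away from \<open>0\<close>, so that the approximation can be normalized
      there.\<close>
    define \<delta> where "\<delta> = (if f x0 = 0 then e / 2 else 0)"
    define d where "d = min (e / 2) (cmod (f x0 + of_real \<delta>) / 2)"
    have \<delta>: "f x0 + of_real \<delta> \<noteq> 0" "0 \<le> \<delta>" "\<delta> \<le> e / 2"
      using e by (auto simp: \<delta>_def)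
    then have "d > 0"
      using e by (simp add: d_def)
    then have "\<exists>r\<in>D. \<forall>x\<in>insert x0 T. cmod ((f x + of_real \<delta>) - r x) \<le> d"
      using T by (intro dense polynomial_Cn_add polynomial_Cn_const f) auto
    then obtain r where r: "r \<in> D" "\<And>x. x \<in> insert x0 T \<Longrightarrow> cmod ((f x + of_real \<delta>) - r x) \<le> d"
      by blast
    have rx0: "r x0 \<noteq> 0"
      using r(2)[of x0] \<delta>(1) by (auto simp: d_def)
    obtain n where n: "p n = (\<lambda>z. r z / r x0)"
      using surj[OF r(1) rx0] by blast
    have "cmod (f x - r x0 * p n x) \<le> e" if "x \<in> T" for x
    proof -
      have "f x - r x0 * p n x = (f x + of_real \<delta> - r x) - of_real \<delta>"
        using rx0 by (simp add: n)
      also have "cmod \<dots> \<le> d + \<delta>"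
        using norm_triangle_ineq4[of "f x + of_real \<delta> - r x" "of_real \<delta>"] r(2)[of x] that \<delta>(2) by simp
      also have "\<dots> \<le> e"
        using \<delta>(3) by (simp add: d_def)
      finally show ?thesis .
    qed
    then show "\<exists>n c. c \<noteq> 0 \<and> (\<forall>x\<in>T. cmod (f x - c * p n x) \<le> e)"
      using rx0 by blast
  next
    fix w :: "complex ^ 'n" and T :: "(complex ^ 'n) set"
    assume w: "w \<noteq> x0" and T: "compact T"
    then obtain i where i: "w $ i \<noteq> x0 $ i"
      by (auto simp: vec_eq_iff)
    define f where "f z = 1 - (z $ i - x0 $ i) / (w $ i - x0 $ i)" for z
    have f: "polynomial_Cn f" "f x0 = 1" "f w = 0"
      unfolding f_def[abs_def] using i by (intro polynomial_Cn_intros, auto)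
    obtain B where B: "B \<ge> 1" "\<And>x. x \<in> T \<Longrightarrow> cmod (f x) \<le> B"
      using polynomial_Cn_bounded[OF f(1) T] by blast
    have "\<exists>n. cmod (p n w) \<le> e \<and> (\<forall>x\<in>T. cmod (p n x) \<le> 2 * B + 1)" if e: "e > 0" for e
    proof -
      have "min (e / 2) (1 / 2) > 0"
        using e by simp
      then have "\<exists>r\<in>D. \<forall>x\<in>insert x0 (insert w T). cmod (f x - r x) \<le> min (e / 2) (1 / 2)"
        using T by (intro dense f) auto
      then obtain r where r: "r \<in> D"
        "\<And>x. x \<in> insert x0 (insert w T) \<Longrightarrow> cmod (f x - r x) \<le> min (e / 2) (1 / 2)"
        by blast
      have rx0: "1 / 2 \<le> cmod (r x0)"
        using norm_triangle_ineq2[of 1 "1 - r x0"] r(2)[of x0] f(2) by simp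
      then obtain n where n: "p n = (\<lambda>z. r z / r x0)"
        using surj[OF r(1)] by force
      have bd: "cmod (p n x) \<le> 2 * b" if "cmod (r x) \<le> b" for x b
      proof -
        have "cmod (r x) / cmod (r x0) \<le> b / (1 / 2)"
          using that rx0 order_trans[OF norm_ge_zero that] by (intro frac_le) auto
        then show ?thesis
          by (simp add: n norm_divide)
      qed
      have "cmod (r w) \<le> e / 2"
        using r(2)[of w] f(3) by simp
      then have "cmod (p n w) \<le> e"
        using bd[of w "e / 2"] by simp
      moreover have "cmod (p n x) \<le> 2 * B + 1" if "x \<in> T" for x
      proof -
        have "cmod (r x) \<le> B + 1 / 2"
          using norm_triangle_ineq4[of "f x" "f x - r x"] r(2)[of x] B(2)[OF that] that by simp
        then show ?thesis
          using bd[of x "B + 1 / 2"] by simp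
      qed
      ultimately show ?thesis by blast
    qed
    then show "\<exists>K\<ge>1. \<forall>e>0. \<exists>n. cmod (p n w) \<le> e \<and> (\<forall>x\<in>T. cmod (p n x) \<le> K)"
      using B(1) by (intro exI[of _ "2 * B + 1"]) auto
  qed
qed

section \<open>The compact set\<close>

text \<open>Subvarieties enter only as closed sets \<open>V\<close> for which \<open>x0\<close> is in the polynomial hull of \<open>S \<inter> V\<close>; so
this part is pure function theory on compact sets.\<close>

lemma compact_subset_from_tower:
  fixes S :: "(complex ^ 'n) set"
  assumes S: "compact S"
  obtains X where "X \<subseteq> S" "compact X"
    "\<And>V. closed V \<Longrightarrow> x0 \<in> poly_hull (S \<inter> V) \<Longrightarrow> V \<inter> X \<noteq> {}"
    "X \<noteq> {} \<Longrightarrow> dense_invertibles X"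
    "x0 \<in> poly_hull X \<Longrightarrow> one_point_gleason_part X x0"
proof -
  obtain p :: "nat \<Rightarrow> complex ^ 'n \<Rightarrow> complex"
    where p: "\<And>n. polynomial_Cn (p n)" "\<And>n. p n x0 = 1"
    and dense: "\<And>f T e. \<lbrakk>polynomial_Cn f; compact T; e > 0\<rbrakk> \<Longrightarrow>
       \<exists>n c. c \<noteq> 0 \<and> (\<forall>x\<in>T. cmod (f x - c * p n x) \<le> e)"
    and small: "\<And>w T. \<lbrakk>w \<noteq> x0; compact T\<rbrakk> \<Longrightarrow>
       \<exists>K\<ge>1. \<forall>e>0. \<exists>n. cmod (p n w) \<le> e \<and> (\<forall>x\<in>T. cmod (p n x) \<le> K)"
    using normalized_dense_polynomials[of x0] by blast
  \<comment> \<open>The least admissible bounds are used, since below they must stay bounded along with \<open>p n\<close> on \<open>S\<close>.\<close>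
  define K where "K n = max 1 (SUP x\<in>S. cmod (p n x))" for n
  have K1: "K n \<ge> 1" for n
    by (simp add: K_def)
  have K2: "\<forall>x\<in>S. cmod (p n x) \<le> K n" for n
  proof
    fix x assume "x \<in> S"
    obtain B where "B \<ge> 1" "\<And>x. x \<in> S \<Longrightarrow> cmod (p n x) \<le> B"
      using polynomial_Cn_bounded[OF p(1) S] by blast
    then have "bdd_above ((\<lambda>x. cmod (p n x)) ` S)"
      by (intro bdd_aboveI2)
    then have "cmod (p n x) \<le> (SUP x\<in>S. cmod (p n x))"
      by (intro cSUP_upper \<open>x \<in> S\<close>)
    then show "cmod (p n x) \<le> K n"
      by (simp add: K_def)
  qed
  obtain Q g where Q: "\<And>n. polynomial_Cn (Q n)" "\<And>n. Q n x0 = 1"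
    and g: "\<And>n. polynomial_Cn (g n)" "\<And>n z. Q (Suc n) z = p n z * g n z"
    and Q_small: "\<And>n x. x \<in> S \<Longrightarrow> Re (Q n x) < 1 / 2 \<Longrightarrow> cmod (Q (Suc n) x) \<le> 1 / 4"
    and g_bound: "\<And>n z C. cmod (Q n z) \<le> C \<Longrightarrow> cmod (g n z) \<le> exp ((4 * ln (4 * K n) + 1) * C)"
    using polynomial_tower[where p = p and K = K, OF S p K1 K2] by metis
  define N where "N n = {x \<in> S. 1 / 2 \<le> Re (Q n x)}" for n
  define X where "X = (\<Inter>n. N n)"
  have N_compact: "compact (N n)" for n
  proof -
    have "closed {x. 1 / 2 \<le> Re (Q n x)}"
      by (intro closed_Collect_le continuous_intros polynomial_Cn_continuous Q)
    then have "compact (S \<inter> {x. 1 / 2 \<le> Re (Q n x)})"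
      by (rule compact_Int_closed[OF S])
    then show ?thesis
      by (simp add: N_def Int_def)
  qed
  have "N (Suc n) \<subseteq> N n" for n
  proof
    fix x assume x: "x \<in> N (Suc n)"
    then have "\<not> cmod (Q (Suc n) x) \<le> 1 / 4"
      using complex_Re_le_cmod[of "Q (Suc n) x"] by (simp add: N_def)
    then show "x \<in> N n"
      using Q_small[of x n] x by (force simp: N_def)
  qed
  then have N_mono: "m \<le> n \<Longrightarrow> N n \<subseteq> N m" for m n
    by (rule lift_Suc_antimono_le)
  have X: "X \<subseteq> S" "compact X"
    unfolding X_def using N_compact by (auto simp: N_def intro!: compact_Inter)
  have ReQ: "1 / 2 \<le> Re (Q n x)" if "x \<in> X" for n x
    using that by (auto simp: X_def N_def)
  show ?thesis
  proof (rule that[OF X])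
    fix V :: "(complex ^ 'n) set"
    assume V: "closed V" "x0 \<in> poly_hull (S \<inter> V)"
    have "\<Inter> (range (\<lambda>n. N n \<inter> V)) \<noteq> {}"
    proof (rule compact_nest)
      show "compact (N n \<inter> V)" for n
        by (intro compact_Int_closed N_compact V)
      show "N n \<inter> V \<subseteq> N m \<inter> V" if "m \<le> n" for m n
        using N_mono[OF that] by blast
      show "N n \<inter> V \<noteq> {}" for n
      proof
        assume "N n \<inter> V = {}"
        then have "cmod (Q (Suc n) x) \<le> 1 / 4" if "x \<in> S \<inter> V" for x
          using that Q_small[of x n] by (force simp: N_def)
        then have "cmod (Q (Suc n) x0) \<le> 1 / 4"
          by (rule poly_hull_bound[OF V(2) Q(1)])
        then show False
          by (simp add: Q(2))
      qed
    qed
    then show "V \<inter> X \<noteq> {}"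
      by (auto simp: X_def)
  next
    assume X0: "X \<noteq> {}"
    show "dense_invertibles X"
    proof (rule dense_invertiblesI[OF X(2) X0])
      fix f :: "complex ^ 'n \<Rightarrow> complex" and e :: real
      assume "polynomial_Cn f" "e > 0"
      then obtain n c where c: "c \<noteq> 0" "\<forall>x\<in>X. cmod (f x - c * p n x) \<le> e"
        using dense[OF _ X(2)] by blast
      \<comment> \<open>\<open>p n\<close> divides \<open>Q (Suc n)\<close>, which is invertible.\<close>
      define u where "u = (\<lambda>x\<in>X. restrict (\<lambda>x. g n x / c) X x * (\<lambda>x\<in>X. 1 / Q (Suc n) x) x)"
      have "(\<lambda>x\<in>X. 1 / Q (Suc n) x) \<in> PX X"
        by (rule PX_inverse_of_polynomial[OF X(2) X0 Q(1) _ ReQ]) simp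
      then have "u \<in> PX X"
        unfolding u_def
        by (rule PX_mult[OF X(2) X0 polynomial_in_PX[OF X(2) X0 polynomial_Cn_divide[OF g(1)]]])
      moreover have "restrict (\<lambda>x. c * p n x) X x * u x = 1" if "x \<in> X" for x
      proof -
        have "Q (Suc n) x \<noteq> 0"
          using ReQ[OF that, of "Suc n"] by auto
        then show ?thesis
          using that c(1) by (simp add: u_def g(2))
      qed
      moreover have "restrict (\<lambda>x. c * p n x) X \<in> PX X"
        by (intro polynomial_in_PX polynomial_Cn_cmult p X(2) X0)
      ultimately have "invertible_in_PX X (restrict (\<lambda>x. c * p n x) X)"
        unfolding invertible_in_PX_def by blast
      then show "\<exists>q. invertible_in_PX X (restrict q X) \<and> (\<forall>x\<in>X. cmod (f x - q x) \<le> e)"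
        using c(2) by (intro exI[of _ "\<lambda>x. c * p n x"] conjI)
    qed
  next
    assume x0: "x0 \<in> poly_hull X"
    show "one_point_gleason_part X x0"
    proof (rule one_point_gleason_partI[OF X(2) x0])
      fix w :: "complex ^ 'n" and C :: real
      assume w: "w \<in> poly_hull X" "w \<noteq> x0"
      have "S \<noteq> {}"
        using w(1) X(1) by (auto simp: poly_hull_def)
      \<comment> \<open>\<open>B\<close> is what \<open>|Q n w|\<close> must reach in order that \<open>2 * Q n - 1\<close> has modulus at least \<open>C\<close> at \<open>w\<close>.\<close>
      define B where "B = (C + 1) / 2"
      have "\<exists>n. B \<le> cmod (Q n w)"
      proof (rule ccontr)
        assume "\<not> ?thesis"
        then have less: "cmod (Q n w) < B" for n
          by (simp add: not_le)
        then have "B > 0"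
          using norm_ge_zero order_le_less_trans by blast
        obtain K' where K': "K' \<ge> 1"
          "\<And>e. e > 0 \<Longrightarrow> \<exists>n. cmod (p n w) \<le> e \<and> (\<forall>x\<in>S. cmod (p n x) \<le> K')"
          using small[OF w(2) S] by blast
        define E where "E = exp ((4 * ln (4 * K') + 1) * B)"
        have "E > 0"
          by (simp add: E_def)
        then obtain n where n: "cmod (p n w) \<le> 1 / (4 * E)" "\<forall>x\<in>S. cmod (p n x) \<le> K'"
          using K'(2)[of "1 / (4 * E)"] by auto
        have "(SUP x\<in>S. cmod (p n x)) \<le> K'"
          using n(2) \<open>S \<noteq> {}\<close> by (intro cSUP_least) auto
        then have "K n \<le> K'"
          using K'(1) by (simp add: K_def)
        then have "4 * ln (4 * K n) + 1 \<le> 4 * ln (4 * K') + 1"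
          using K1[of n] by simp
        then have "(4 * ln (4 * K n) + 1) * B \<le> (4 * ln (4 * K') + 1) * B"
          using \<open>B > 0\<close> by (intro mult_right_mono) auto
        then have "cmod (g n w) \<le> E"
          using g_bound[OF less_imp_le[OF less], of n] unfolding E_def
          by (meson exp_le_cancel_iff order_trans)
        then have "cmod (Q (Suc n) w) \<le> 1 / (4 * E) * E"
          unfolding g(2) norm_mult using n(1) \<open>E > 0\<close> by (intro mult_mono) auto
        then have "cmod (Q (Suc n) w) \<le> 1 / 4"
          using \<open>E > 0\<close> by simp
        moreover have "1 / 2 \<le> cmod (Q (Suc n) w)"
          by (rule poly_hull_ge_norm_if_Re_ge[OF X(2) w(1) Q(1) _ ReQ]) simp
        ultimately show False
          by simp
      qed
      then obtain n where n: "B \<le> cmod (Q n w)" ..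
      define h where "h x = 2 * Q n x - 1" for x
      have "polynomial_Cn h"
        unfolding h_def[abs_def] by (intro polynomial_Cn_intros Q)
      moreover have "0 \<le> Re (h x)" if "x \<in> X" for x
        using ReQ[OF that, of n] by (simp add: h_def)
      moreover have "h x0 = 1"
        by (simp add: h_def Q(2))
      moreover have "C \<le> cmod (h w)"
        using norm_triangle_ineq2[of "2 * Q n w" 1] n by (simp add: h_def B_def norm_mult)
      ultimately show "\<exists>h. polynomial_Cn h \<and> (\<forall>x\<in>X. 0 \<le> Re (h x)) \<and> h x0 = 1 \<and> C \<le> cmod (h w)"
        by blast
    qed
  qed
qed

section \<open>Polynomial hypersurfaces\<close>

lemma polynomial_Cn_holomorphic:
  assumes "polynomial_Cn p"
  shows "holomorphic_Cn p U"
proof -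
  obtain q where q: "\<forall>z. (p has_derivative (\<lambda>h. \<Sum>i\<in>UNIV. q i z * h $ i)) (at z)"
    using polynomial_Cn_has_derivative[OF assms] by blast
  show ?thesis
    unfolding holomorphic_Cn_def
  proof (intro ballI exI conjI)
    fix z
    show "(p has_derivative (\<lambda>h. \<Sum>i\<in>UNIV. q i z * h $ i)) (at z)"
      using q by blast
    show "\<forall>c v. (\<Sum>i\<in>UNIV. q i z * (c *s v) $ i) = c * (\<Sum>i\<in>UNIV. q i z * v $ i)"
      by (simp add: sum_distrib_left mult_ac)
  qed
qed

lemma analytic_subvariety_closed:
  assumes "analytic_subvariety V"
  shows "closed V"
proof -
  have "\<exists>T. open T \<and> a \<in> T \<and> T \<subseteq> - V" if a: "a \<notin> V" for a
  proof -
    obtain U F where "open U \<and> a \<in> U \<and> finite F \<and> (\<forall>f\<in>F. holomorphic_Cn f U) \<and>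
        V \<inter> U = {z \<in> U. \<forall>f\<in>F. f z = 0}"
      using assms[unfolded analytic_subvariety_def, THEN spec, of a] by (elim exE)
    then have U: "open U" "a \<in> U" "\<forall>f\<in>F. holomorphic_Cn f U"
      "V \<inter> U = {z \<in> U. \<forall>f\<in>F. f z = 0}"
      by auto
    have "a \<notin> V \<inter> U"
      using a by simp
    then obtain f where f: "f \<in> F" "f a \<noteq> 0"
      unfolding U(4) using U(2) by blast
    have "continuous_on U f"
    proof (rule continuous_at_imp_continuous_on, rule ballI)
      fix z assume "z \<in> U"
      then obtain D where "(f has_derivative D) (at z)"
        using U(3) f(1) unfolding holomorphic_Cn_def by blast
      then show "isCont f z"
        by (rule has_derivative_continuous)
    qed
    then have "open (U \<inter> f -` (- {0}))"
      by (intro continuous_open_preimage U(1)) auto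
    moreover have "U \<inter> f -` (- {0}) \<subseteq> - V"
      using U(4) f(1) by blast
    ultimately show ?thesis
      using U(2) f(2) by (intro exI[of _ "U \<inter> f -` (- {0})"]) auto
  qed
  then have "open (- V)"
    by (subst open_subopen) blast
  then show ?thesis
    by (simp add: closed_def)
qed

lemma regular_point_dim_le:
  fixes V :: "(complex ^ 'n) set"
  assumes "regular_point V d b"
  shows "d \<le> CARD('n)"
proof -
  obtain J :: "'n set" where "card J = d"
    using assms unfolding regular_point_def by (elim exE conjE)
  then show ?thesis
    using card_mono[of UNIV J] by simp
qed

text \<open>The upper bound on the dimensions of regular points also makes the set finite whose maximum is taken.\<close>

lemma dim_at_eqI:
  assumes "\<And>U. open U \<Longrightarrow> a \<in> U \<Longrightarrow> \<exists>b\<in>U. regular_point V m b"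
    and le: "\<And>b d. regular_point V d b \<Longrightarrow> d \<le> m"
  shows "dim_at V a = m"
proof -
  define D where "D = {d. \<forall>U. open U \<and> a \<in> U \<longrightarrow> (\<exists>b\<in>U. regular_point V d b)}"
  have *: "d \<le> m" if d: "d \<in> D" for d
  proof -
    obtain b where "regular_point V d b"
      using d[unfolded D_def mem_Collect_eq, THEN spec, of UNIV] by auto
    then show ?thesis
      by (rule le)
  qed
  then have "D \<subseteq> {..m}"
    by blast
  then have "finite D"
    by (rule finite_subset) simp
  moreover have "m \<in> D"
    unfolding D_def using assms(1) by simp
  ultimately have "Max D = m"
    using * by (intro Max_eqI)
  then show ?thesis
    unfolding dim_at_def D_def .
qed

lemma pure_codim_subvariety_UNIV: "pure_codim_subvariety 0 (UNIV :: (complex ^ 'n) set)"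
proof -
  have "analytic_subvariety (UNIV :: (complex ^ 'n) set)"
    unfolding analytic_subvariety_def
    by (rule allI, rule exI[of _ UNIV], rule exI[of _ "{}"]) simp
  moreover have "regular_point (UNIV :: (complex ^ 'n) set) CARD('n) b" for b
  proof -
    have hol: "holomorphic_Cn (\<lambda>z :: complex ^ 'n. z $ i) UNIV" for i
      by (intro polynomial_Cn_holomorphic polynomial_Cn_coord)
    show ?thesis
      unfolding regular_point_def
      by (rule conjI, rule UNIV_I, rule exI[of _ UNIV], rule exI[of _ UNIV],
          rule exI[of _ "\<lambda>z. z"], rule exI[of _ "\<lambda>z. z"], rule exI[of _ UNIV])
         (simp add: hol homeomorphism_ident)
  qed
  then have "dim_at (UNIV :: (complex ^ 'n) set) a = CARD('n)" for a
    using dim_at_eqI[of a UNIV "CARD('n)"] regular_point_dim_le[of UNIV] by blast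
  ultimately show ?thesis
    by (simp add: pure_codim_subvariety_def pure_dim_def)
qed

text \<open>At a regular point of dimension \<open>N\<close> the zero set would contain a nonempty open set, and \<open>p\<close>
would vanish identically.\<close>

lemma hypersurface_regular_point_dim:
  fixes p :: "complex ^ 'n \<Rightarrow> complex"
  assumes p: "polynomial_Cn p" "p z1 \<noteq> 0" and reg: "regular_point {z. p z = 0} d b"
  shows "d \<le> CARD('n) - 1"
proof (rule ccontr)
  assume "\<not> ?thesis"
  then have "d = CARD('n)"
    using regular_point_dim_le[OF reg] by simp
  obtain U W \<Phi> \<Psi> and J :: "'n set"
    where "open U \<and> b \<in> U \<and> open W \<and> homeomorphism U W \<Phi> \<Psi> \<and>
        (\<forall>i. holomorphic_Cn (\<lambda>z. \<Phi> z $ i) U) \<and> (\<forall>i. holomorphic_Cn (\<lambda>w. \<Psi> w $ i) W) \<and>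
        card J = d \<and> \<Phi> ` ({z. p z = 0} \<inter> U) = {w \<in> W. \<forall>i. i \<notin> J \<longrightarrow> w $ i = 0}"
    using reg unfolding regular_point_def by (elim exE conjE[of "b \<in> {z. p z = 0}"])
  then have U: "open U" "b \<in> U" "homeomorphism U W \<Phi> \<Psi>" "card J = CARD('n)"
      "\<Phi> ` ({z. p z = 0} \<inter> U) = {w \<in> W. \<forall>i. i \<notin> J \<longrightarrow> w $ i = 0}"
    using \<open>d = CARD('n)\<close> by simp_all
  have "J = UNIV"
    using U(4) by (intro card_subset_eq) auto
  then have "\<Phi> ` ({z. p z = 0} \<inter> U) = \<Phi> ` U"
    using U(5) homeomorphism_image1[OF U(3)] by simp
  moreover have "inj_on \<Phi> U"
    by (rule inj_on_inverseI[of _ \<Psi>]) (rule homeomorphism_apply1[OF U(3)])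
  ultimately have "{z. p z = 0} \<inter> U = U"
    by (simp add: inj_on_image_eq_iff)
  then have "p z = 0" if "z \<in> U" for z
    using that by blast
  then have "p z1 = 0"
    by (rule polynomial_Cn_identity[OF p(1) U(1,2)])
  then show False
    using p(2) by simp
qed

text \<open>A weak form of Hurwitz's theorem. If \<open>p\<close> had no zero on the disc of radius \<open>s\<close> in a nearby parallel line,
then by the maximum principle for \<open>1 / p\<close> its modulus at the centre would be at least half of its minimum
on the original circle; but it is close to \<open>p b = 0\<close>.\<close>

lemma zero_on_line_persists:
  fixes p :: "complex ^ 'n \<Rightarrow> complex"
  assumes p: "polynomial_Cn p" "p b = 0" and nz: "p (b + t0 *s v) \<noteq> 0" and r: "r > 0"
  obtains \<delta> where "\<delta> > 0" "\<And>z. dist z b < \<delta> \<Longrightarrow> \<exists>t. cmod t < r \<and> p (z + t *s v) = 0"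
proof -
  obtain C where C: "\<And>z t. p (z + t *s v) = poly (C z) t"
    using polynomial_Cn_on_line[OF p(1), of v] by blast
  have "C b \<noteq> 0"
    using nz C[of b t0] by auto
  then have fin: "finite {t. poly (C b) t = 0}"
    by (rule poly_roots_finite)
  obtain d where d: "d > 0" "\<And>t. poly (C b) t = 0 \<Longrightarrow> t \<noteq> 0 \<Longrightarrow> d \<le> cmod t"
    using finite_set_avoid[OF fin, of 0] by (auto simp: dist_norm)
  define s where "s = min (r / 2) (d / 2)"
  have s: "0 < s" "s < r" "s < d"
    using r d(1) by (auto simp: s_def)
  have nz_sphere: "poly (C b) t \<noteq> 0" if "t \<in> sphere 0 s" for t
    using d(2)[of t] that s by auto
  have "\<exists>x\<in>sphere 0 s. \<forall>y\<in>sphere 0 s. cmod (poly (C b) x) \<le> cmod (poly (C b) y)"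
    using s(1) by (intro continuous_attains_inf continuous_intros) auto
  then obtain t1 where t1: "t1 \<in> sphere 0 s" "\<And>t. t \<in> sphere 0 s \<Longrightarrow> cmod (poly (C b) t1) \<le> cmod (poly (C b) t)"
    by blast
  define \<epsilon> where "\<epsilon> = cmod (poly (C b) t1)"
  have \<epsilon>: "\<epsilon> > 0"
    using nz_sphere[OF t1(1)] by (simp add: \<epsilon>_def)
  define F where "F y = p (fst y + snd y *s v)" for y :: "(complex ^ 'n) \<times> complex"
  have "continuous_on UNIV (\<lambda>y :: (complex ^ 'n) \<times> complex. fst y + snd y *s v)"
    unfolding vector_scalar_mult_def by (intro continuous_intros)
  then have "continuous_on T F" for T
    unfolding F_def
    by (intro continuous_on_compose2[OF polynomial_Cn_continuous[OF p(1), of UNIV]])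
       (auto intro: continuous_on_subset)
  then have "uniformly_continuous_on (cball b 1 \<times> cball 0 s) F"
    by (intro compact_uniformly_continuous compact_Times) auto
  then obtain \<delta> where \<delta>: "\<delta> > 0" "\<And>y y'. y \<in> cball b 1 \<times> cball 0 s \<Longrightarrow> y' \<in> cball b 1 \<times> cball 0 s \<Longrightarrow>
      dist y' y < \<delta> \<Longrightarrow> dist (F y') (F y) < \<epsilon> / 2"
    unfolding uniformly_continuous_on_def using \<epsilon> by (metis half_gt_zero)
  show ?thesis
  proof (rule that[of "min \<delta> 1"])
    fix z assume z: "dist z b < min \<delta> 1"
    have close: "cmod (poly (C z) t - poly (C b) t) < \<epsilon> / 2" if "t \<in> cball 0 s" for t
    proof -
      have "dist (z, t) (b, t) < \<delta>"
        using z by (simp add: dist_Pair_Pair)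
      then have "dist (F (z, t)) (F (b, t)) < \<epsilon> / 2"
        using z that by (intro \<delta>(2)) (auto simp: dist_commute)
      then show ?thesis
        by (simp add: F_def C dist_norm)
    qed
    have "\<exists>t\<in>cball 0 s. poly (C z) t = 0"
    proof (rule ccontr)
      assume "\<not> ?thesis"
      then have nz: "poly (C z) t \<noteq> 0" if "t \<in> cball 0 s" for t
        using that by blast
      have "cmod (1 / poly (C z) 0) \<le> 1 / (\<epsilon> / 2)"
      proof (rule maximum_modulus_frontier[where f = "\<lambda>t. 1 / poly (C z) t" and S = "cball 0 s"])
        show "(\<lambda>t. 1 / poly (C z) t) holomorphic_on interior (cball 0 s)"
          using nz interior_subset by (intro holomorphic_intros) blast
        show "continuous_on (closure (cball 0 s)) (\<lambda>t. 1 / poly (C z) t)"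
          using nz by (intro continuous_intros) auto
        fix t :: complex assume "t \<in> frontier (cball 0 s)"
        then have t: "t \<in> sphere 0 s" "t \<in> cball 0 s"
          using s(1) by (auto simp: frontier_cball)
        have "\<epsilon> \<le> cmod (poly (C b) t)"
          using t1(2)[OF t(1)] by (simp add: \<epsilon>_def)
        then have "\<epsilon> / 2 \<le> cmod (poly (C z) t)"
          using close[OF t(2)] norm_triangle_ineq2[of "poly (C b) t" "poly (C z) t"]
          by (simp add: norm_minus_commute)
        then show "cmod (1 / poly (C z) t) \<le> 1 / (\<epsilon> / 2)"
          unfolding norm_divide norm_one using \<epsilon> by (intro divide_left_mono mult_pos_pos) auto
      qed (use s(1) in auto)
      moreover have "cmod (poly (C z) 0) < \<epsilon> / 2"
        using close[of 0] C[of b 0] p(2) s(1) by simp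
      moreover have "cmod (poly (C z) 0) > 0"
        using nz[of 0] s(1) by simp
      ultimately show False
        using \<epsilon> by (simp add: norm_divide divide_simps split: if_splits)
    qed
    then obtain t where "cmod t \<le> s" "poly (C z) t = 0"
      by auto
    then show "\<exists>t. cmod t < r \<and> p (z + t *s v) = 0"
      using s(2) C by (intro exI[of _ t]) auto
  qed (use \<delta>(1) in simp)
qed

definition directional_deriv :: "complex ^ 'n \<Rightarrow> (complex ^ 'n \<Rightarrow> complex) \<Rightarrow> complex ^ 'n \<Rightarrow> complex" where
  "directional_deriv v f z = frechet_derivative f (at z) v"

lemma polynomial_Cn_partials:
  assumes "polynomial_Cn f"
  obtains q where "\<And>i. polynomial_Cn (q i)"
    "\<And>z. (f has_derivative (\<lambda>h. \<Sum>i\<in>UNIV. q i z * h $ i)) (at z)"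
    "\<And>v z. directional_deriv v f z = (\<Sum>i\<in>UNIV. q i z * v $ i)"
proof -
  obtain q where q: "\<And>i. polynomial_Cn (q i)"
    "\<And>z. (f has_derivative (\<lambda>h. \<Sum>i\<in>UNIV. q i z * h $ i)) (at z)"
    using polynomial_Cn_has_derivative[OF assms] by blast
  moreover have "directional_deriv v f z = (\<Sum>i\<in>UNIV. q i z * v $ i)" for v z
    unfolding directional_deriv_def frechet_derivative_at[OF q(2), symmetric] ..
  ultimately show ?thesis
    by (rule that)
qed

lemma directional_deriv_polynomial:
  assumes "polynomial_Cn f"
  shows "polynomial_Cn (directional_deriv v f)"
proof -
  obtain q where q: "\<And>i. polynomial_Cn (q i)"
    "\<And>z. (f has_derivative (\<lambda>h. \<Sum>i\<in>UNIV. q i z * h $ i)) (at z)"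
    "\<And>v z. directional_deriv v f z = (\<Sum>i\<in>UNIV. q i z * v $ i)"
    by (rule polynomial_Cn_partials[OF assms]) (rule that)
  have "directional_deriv v f = (\<lambda>z. \<Sum>i\<in>UNIV. q i z * v $ i)"
    by (rule ext) (rule q(3))
  moreover have "polynomial_Cn (\<lambda>z. \<Sum>i\<in>UNIV. q i z * v $ i)"
    by (intro polynomial_Cn_sum polynomial_Cn_mult polynomial_Cn_const q(1))
  ultimately show ?thesis
    by simp
qed

lemma higher_directional_deriv_polynomial:
  "polynomial_Cn f \<Longrightarrow> polynomial_Cn ((directional_deriv v ^^ k) f)"
  by (induction k) (simp_all add: directional_deriv_polynomial)

lemma has_derivative_on_line: "((\<lambda>t. z + t *s v) has_derivative (\<lambda>t. t *s v)) (at t)"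
  for z v :: "complex ^ 'n"
proof -
  have lin: "bounded_linear (\<lambda>t::complex. t *s v)"
    unfolding linear_conv_bounded_linear[symmetric]
    by (intro linearI) (vector algebra_simps)+
  show ?thesis
    using has_derivative_add[OF has_derivative_const[of z] bounded_linear_imp_has_derivative[OF lin]]
    by simp
qed

text \<open>Directional derivatives of a polynomial are the formal derivatives of its restrictions to lines; this makes
algebra of polynomials in one variable available.\<close>

lemma poly_pderiv_on_line:
  assumes f: "polynomial_Cn f" and q: "\<And>t. f (z + t *s v) = poly q t"
  shows "directional_deriv v f (z + t *s v) = poly (pderiv q) t"
proof -
  obtain a where a: "\<And>i. polynomial_Cn (a i)"
    "\<And>z. (f has_derivative (\<lambda>h. \<Sum>i\<in>UNIV. a i z * h $ i)) (at z)"
    "\<And>v z. directional_deriv v f z = (\<Sum>i\<in>UNIV. a i z * v $ i)"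
    by (rule polynomial_Cn_partials[OF f]) (rule that)
  have "((\<lambda>s. f (z + s *s v)) has_derivative (\<lambda>s. \<Sum>i\<in>UNIV. a i (z + t *s v) * (s *s v) $ i)) (at t)"
    by (rule has_derivative_compose[OF has_derivative_on_line a(2)])
  also have "(\<lambda>s. \<Sum>i\<in>UNIV. a i (z + t *s v) * (s *s v) $ i) = (*) (directional_deriv v f (z + t *s v))"
    unfolding a(3) by (auto simp: fun_eq_iff sum_distrib_left mult_ac)
  finally have "(poly q has_field_derivative directional_deriv v f (z + t *s v)) (at t)"
    unfolding has_field_derivative_def q .
  then show ?thesis
    by (rule DERIV_unique[OF _ poly_DERIV])
qed

lemma poly_higher_pderiv_on_line:
  assumes f: "polynomial_Cn f" and q: "\<And>t. f (z + t *s v) = poly q t"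
  shows "(directional_deriv v ^^ k) f (z + t *s v) = poly ((pderiv ^^ k) q) t"
proof (induction k arbitrary: t)
  case (Suc k)
  show ?case
    using poly_pderiv_on_line[OF higher_directional_deriv_polynomial[OF f] Suc.IH] by simp
qed (simp add: q)

lemma higher_directional_deriv_nonzero:
  fixes f :: "complex ^ 'n \<Rightarrow> complex"
  assumes f: "polynomial_Cn f" and nz: "f (z + t *s v) \<noteq> 0"
  obtains k where "(directional_deriv v ^^ k) f z \<noteq> 0"
proof -
  obtain q where q: "\<And>t. f (z + t *s v) = poly q t"
    using polynomial_Cn_on_line[OF f, of v] by blast
  have "\<exists>k. (directional_deriv v ^^ k) f z \<noteq> 0"
  proof (rule ccontr)
    assume "\<not> ?thesis"
    then have "poly ((pderiv ^^ k) q) 0 = 0" for k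
      using poly_higher_pderiv_on_line[OF f q, of k 0] by simp
    then have "coeff ((pderiv ^^ k) q) 0 = 0" for k
      by (simp add: poly_0_coeff_0)
    then have "coeff q k = 0" for k
      by (simp add: coeff_higher_pderiv pochhammer_fact[symmetric])
    then have "q = 0"
      by (simp add: poly_eq_iff)
    then show False
      using nz q by simp
  qed
  then show ?thesis
    using that by blast
qed

lemma has_derivative_vecI:
  fixes f :: "'a::real_normed_vector \<Rightarrow> 'b::euclidean_space ^ 'n"
  assumes "\<And>i. ((\<lambda>x. f x $ i) has_derivative (\<lambda>h. f' h $ i)) (at a)"
  shows "(f has_derivative f') (at a)"
proof -
  have "((\<lambda>x. f x \<bullet> axis i u) has_derivative (\<lambda>h. f' h \<bullet> axis i u)) (at a)" for i u
    unfolding inner_axis by (intro has_derivative_inner_left assms)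
  then show ?thesis
    by (subst has_derivative_componentwise_within) (auto simp: Basis_vec_def)
qed

text \<open>Replace one coordinate by \<open>g\<close> and the others by linear functions that are constant in the direction \<open>v\<close>.
Since the derivative of \<open>g\<close> along \<open>v\<close> does not vanish at \<open>b\<close>, this map has an injective derivative
there, and the inverse function theorem applies. That inverse is a real one; it is holomorphic because the
inverse of a complex linear bijection is complex linear.\<close>

lemma straighten_level_set:
  fixes g :: "complex ^ 'n \<Rightarrow> complex"
  assumes g: "polynomial_Cn g" and gb: "directional_deriv v g b \<noteq> 0"
  obtains i :: 'n and U W \<Phi> and \<Psi> :: "complex ^ 'n \<Rightarrow> complex ^ 'n" where "open U" "b \<in> U" "open W" "homeomorphism U W \<Phi> \<Psi>"
    "\<And>j. polynomial_Cn (\<lambda>z. \<Phi> z $ j)" "\<And>j. holomorphic_Cn (\<lambda>w. \<Psi> w $ j) W"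
    "\<And>z. \<Phi> z $ i = g z"
    "\<And>z t j. j \<noteq> i \<Longrightarrow> \<Phi> (z + t *s v) $ j = \<Phi> z $ j"
proof -
  obtain q where q: "\<And>i. polynomial_Cn (q i)"
    "\<And>z. (g has_derivative (\<lambda>h. \<Sum>i\<in>UNIV. q i z * h $ i)) (at z)"
    "\<And>v z. directional_deriv v g z = (\<Sum>i\<in>UNIV. q i z * v $ i)"
    by (rule polynomial_Cn_partials[OF g]) (rule that)
  obtain i where i: "v $ i \<noteq> 0"
    using gb unfolding q(3) by (metis (no_types, lifting) mult_zero_right sum.neutral)
  define \<Phi> where "\<Phi> z = (\<chi> j. if j = i then g z else z $ j - (v $ j / v $ i) * z $ i)" for z
  define \<Phi>' where "\<Phi>' z h = (\<chi> j. if j = i then (\<Sum>l\<in>UNIV. q l z * h $ l) else h $ j - (v $ j / v $ i) * h $ i)"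
    for z h :: "complex ^ 'n"
  have comp: "polynomial_Cn (\<lambda>z. \<Phi> z $ j)" for j
  proof -
    have "polynomial_Cn (\<lambda>z. z $ j - (v $ j / v $ i) * z $ i)"
      by (intro polynomial_Cn_diff polynomial_Cn_cmult polynomial_Cn_coord)
    then show ?thesis
      unfolding \<Phi>_def using g by (cases "j = i") simp_all
  qed
  have der: "(\<Phi> has_derivative \<Phi>' z) (at z)" for z
  proof (rule has_derivative_vecI)
    fix j
    have coord: "((\<lambda>z. z $ l) has_derivative (\<lambda>h. h $ l)) (at z)" for l
      by (intro bounded_linear_imp_has_derivative bounded_linear_vec_nth)
    have "((\<lambda>z. z $ j - (v $ j / v $ i) * z $ i) has_derivative (\<lambda>h. h $ j - (v $ j / v $ i) * h $ i)) (at z)"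
      by (intro has_derivative_diff has_derivative_mult_right coord)
    then show "((\<lambda>x. \<Phi> x $ j) has_derivative (\<lambda>h. \<Phi>' z h $ j)) (at z)"
      unfolding \<Phi>_def \<Phi>'_def using q(2) by (cases "j = i") simp_all
  qed
  have bl: "bounded_linear (\<Phi>' z)" for z
    using der by (rule has_derivative_bounded_linear)
  have app: "blinfun_apply (Blinfun (\<Phi>' z)) = \<Phi>' z" for z
    by (rule bounded_linear_Blinfun_apply[OF bl])
  have scale: "\<Phi>' z (c *s h) = c *s \<Phi>' z h" for z c h
    by (simp add: \<Phi>'_def vec_eq_iff sum_distrib_left algebra_simps)
  have cont: "continuous_on UNIV (\<lambda>z. Blinfun (\<Phi>' z))"
  proof (rule continuous_on_blinfun_componentwise)
    fix e :: "complex ^ 'n"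
    have "continuous_on UNIV (\<lambda>z. \<Phi>' z e $ j)" for j
      unfolding \<Phi>'_def
      by (cases "j = i")
         (simp_all add: polynomial_Cn_continuous polynomial_Cn_sum polynomial_Cn_mult polynomial_Cn_const q(1))
    then have "continuous_on UNIV (\<lambda>z. \<chi> j. \<Phi>' z e $ j)"
      by (intro continuous_on_vec_lambda)
    then show "continuous_on UNIV (\<lambda>z. blinfun_apply (Blinfun (\<Phi>' z)) e)"
      by (simp add: app)
  qed
  have "inj (\<Phi>' b)"
  proof (rule linear_injective_0[THEN iffD2, rule_format])
    show "linear (\<Phi>' b)"
      using bl by (rule bounded_linear.linear)
    fix h assume h: "\<Phi>' b h = 0"
    have hj: "h $ j = (h $ i / v $ i) * v $ j" for j
      using arg_cong[OF h, of "\<lambda>x. x $ j"] i by (cases "j = i") (simp_all add: \<Phi>'_def field_simps)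
    then have hv: "h = (h $ i / v $ i) *s v"
      unfolding vec_eq_iff vector_smult_component using hj by blast
    have "0 = (\<Sum>l\<in>UNIV. q l b * h $ l)"
      using arg_cong[OF h, of "\<lambda>x. x $ i"] by (simp add: \<Phi>'_def)
    also have "\<dots> = (h $ i / v $ i) * directional_deriv v g b"
      unfolding q(3) by (subst hv) (simp add: sum_distrib_left mult_ac)
    finally have "h $ i = 0"
      using gb i by simp
    then show "h = 0"
      by (subst hv) simp
  qed
  then obtain B where B: "linear B" "B \<circ> \<Phi>' b = id"
    using linear_injective_left_inverse[OF bounded_linear.linear[OF bl]] by blast
  have "Blinfun B o\<^sub>L Blinfun (\<Phi>' b) = id_blinfun"
  proof (rule blinfun_eqI)
    fix h
    have "blinfun_apply (Blinfun B) = B"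
      using B(1) by (simp add: bounded_linear_Blinfun_apply linear_conv_bounded_linear)
    then show "blinfun_apply (Blinfun B o\<^sub>L Blinfun (\<Phi>' b)) h = blinfun_apply id_blinfun h"
      using fun_cong[OF B(2), of h] by (simp add: app)
  qed
  then obtain U W \<Psi> \<Psi>' where inv: "open U" "b \<in> U" "open W" "homeomorphism U W \<Phi> \<Psi>"
    "\<And>y. y \<in> W \<Longrightarrow> (\<Psi> has_derivative \<Psi>' y) (at y)"
    "\<And>y. y \<in> W \<Longrightarrow> \<Psi>' y = Hilbert_Choice.inv (\<Phi>' (\<Psi> y))"
    "\<And>y. y \<in> W \<Longrightarrow> bij (\<Phi>' (\<Psi> y))"
    using inverse_function_theorem[of UNIV \<Phi> "\<lambda>z. Blinfun (\<Phi>' z)" b "Blinfun B", unfolded app,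
        OF open_UNIV der cont UNIV_I] by metis
  have holo: "holomorphic_Cn (\<lambda>w. \<Psi> w $ j) W" for j
    unfolding holomorphic_Cn_def
  proof (intro ballI exI conjI allI)
    fix y c h assume y: "y \<in> W"
    show "((\<lambda>w. \<Psi> w $ j) has_derivative (\<lambda>h. \<Psi>' y h $ j)) (at y)"
      using bounded_linear.has_derivative[OF bounded_linear_vec_nth inv(5)[OF y]] .
    have "\<Phi>' (\<Psi> y) (c *s \<Psi>' y h) = c *s h"
      unfolding scale inv(6)[OF y] using inv(7)[OF y] by (simp add: bij_is_surj surj_f_inv_f)
    then have "\<Psi>' y (c *s h) = c *s \<Psi>' y h"
      unfolding inv(6)[OF y] using inv(7)[OF y] by (metis bij_inv_eq_iff)
    then show "\<Psi>' y (c *s h) $ j = c * \<Psi>' y h $ j"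
      by simp
  qed
  show ?thesis
  proof (rule that[OF inv(1-4)])
    show "polynomial_Cn (\<lambda>z. \<Phi> z $ j)" "holomorphic_Cn (\<lambda>w. \<Psi> w $ j) W" for j
      by (rule comp, rule holo)
    show "\<Phi> z $ i = g z" for z
      by (simp add: \<Phi>_def)
    show "\<Phi> (z + t *s v) $ j = \<Phi> z $ j" if "j \<noteq> i" for z t j
      using that i by (simp add: \<Phi>_def field_simps)
  qed
qed

text \<open>Near \<open>a\<close>, choose a zero \<open>b\<close> and a direction \<open>v\<close> for which the order \<open>m\<close> of the first nonvanishing
directional derivative is as small as possible among all zeros in \<open>U\<close> and all directions. Then the derivative
\<open>g\<close> of order \<open>m - 1\<close> along \<open>v\<close> vanishes at all zeros of \<open>p\<close> in \<open>U\<close>, and its own derivative along \<open>v\<close>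
does not vanish at \<open>b\<close>. So near \<open>b\<close> the zeros of \<open>p\<close> are contained in the smooth hypersurface \<open>g = 0\<close>.
They fill it: on the line through a point of \<open>g = 0\<close> in the direction \<open>v\<close> there is a zero of \<open>p\<close> nearby,
which also satisfies \<open>g = 0\<close>; both points have the same image under the straightening map of \<open>g\<close>, so
they coincide.\<close>

lemma hypersurface_regular_points_dense:
  fixes p :: "complex ^ 'n \<Rightarrow> complex"
  assumes p: "polynomial_Cn p" "p z1 \<noteq> 0" and a: "p a = 0" and U: "open U" "a \<in> U"
  shows "\<exists>b\<in>U. regular_point {z. p z = 0} (CARD('n) - 1) b"
proof -
  define P where "P m \<longleftrightarrow> (\<exists>b\<in>U. p b = 0 \<and> (\<exists>v. (directional_deriv v ^^ m) p b \<noteq> 0))" for m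
  define m where "m = (LEAST m. P m)"
  have "p (a + 1 *s (z1 - a)) \<noteq> 0"
    using p(2) by simp
  then obtain k0 where "(directional_deriv (z1 - a) ^^ k0) p a \<noteq> 0"
    by (rule higher_directional_deriv_nonzero[OF p(1)])
  then have "P k0"
    unfolding P_def using a U(2) by blast
  then have "P m"
    unfolding m_def by (rule LeastI)
  then obtain b v where b: "b \<in> U" "p b = 0" "(directional_deriv v ^^ m) p b \<noteq> 0"
    unfolding P_def by blast
  have "m \<noteq> 0"
    using b(2,3) by (intro notI) simp
  then obtain k where k: "m = Suc k"
    by (cases m) auto
  define g where "g = (directional_deriv v ^^ k) p"
  have g: "polynomial_Cn g"
    unfolding g_def by (rule higher_directional_deriv_polynomial[OF p(1)])
  have "directional_deriv v g b \<noteq> 0"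
    using b(3) by (simp add: g_def k)
  then obtain i :: 'n and U' W' and \<Phi> \<Psi> :: "complex ^ 'n \<Rightarrow> complex ^ 'n" where \<Phi>: "open U'" "b \<in> U'" "open W'" "homeomorphism U' W' \<Phi> \<Psi>"
    "\<And>j. polynomial_Cn (\<lambda>z. \<Phi> z $ j)" "\<And>j. holomorphic_Cn (\<lambda>w. \<Psi> w $ j) W'"
    "\<And>z. \<Phi> z $ i = g z"
    "\<And>z t j. j \<noteq> i \<Longrightarrow> \<Phi> (z + t *s v) $ j = \<Phi> z $ j"
    by (rule straighten_level_set[OF g]) (rule that; assumption)
  have g0: "g z = 0" if "z \<in> U" "p z = 0" for z
  proof (rule ccontr)
    assume "g z \<noteq> 0"
    then have "P k"
      unfolding P_def g_def using that by blast
    then show False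
      using not_less_Least[of k P] k by (simp add: m_def)
  qed
  have "\<exists>t. p (b + t *s v) \<noteq> 0"
  proof (rule ccontr)
    assume "\<not> ?thesis"
    then have "p (b + t *s v) = poly 0 t" for t
      by simp
    then have "(directional_deriv v ^^ m) p (b + 0 *s v) = poly ((pderiv ^^ m) 0) 0"
      by (rule poly_higher_pderiv_on_line[OF p(1)])
    then show False
      using b(3) by simp
  qed
  then obtain t0 where t0: "p (b + t0 *s v) \<noteq> 0" by blast
  define T where "T = (\<lambda>y :: (complex ^ 'n) \<times> complex. fst y + snd y *s v) -` (U \<inter> U')"
  have "open T"
    unfolding T_def vector_scalar_mult_def
    by (intro open_vimage open_Int U(1) \<Phi>(1) continuous_intros)
  moreover have "(b, 0) \<in> T"
    using b(1) \<Phi>(2) by (simp add: T_def)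
  ultimately obtain A B where AB: "open A" "open B" "(b, 0) \<in> A \<times> B" "A \<times> B \<subseteq> T"
    by (rule open_prod_elim)
  then obtain r where r: "r > 0" "ball 0 r \<subseteq> B"
    using open_contains_ball by (metis SigmaD2)
  obtain \<delta> where \<delta>: "\<delta> > 0" "\<And>z. dist z b < \<delta> \<Longrightarrow> \<exists>t. cmod t < r \<and> p (z + t *s v) = 0"
    using zero_on_line_persists[OF p(1) b(2) t0 r(1)] by blast
  define O' where "O' = A \<inter> ball b \<delta>"
  have O': "open O'" "b \<in> O'"
    using AB(1,3) \<delta>(1) by (auto simp: O'_def)
  have sub: "z + t *s v \<in> U \<inter> U'" if "z \<in> O'" "cmod t < r" for z t
  proof -
    have "(z, t) \<in> T"
      using that r(2) AB(4) by (auto simp: O'_def)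
    then show ?thesis
      by (simp add: T_def)
  qed
  have sub0: "O' \<subseteq> U \<inter> U'"
    using sub[of _ 0] r(1) by auto
  have iff: "p z = 0 \<longleftrightarrow> g z = 0" if z: "z \<in> O'" for z
  proof
    assume "p z = 0"
    then show "g z = 0"
      using g0 sub0 z by blast
  next
    assume gz: "g z = 0"
    obtain t where t: "cmod t < r" "p (z + t *s v) = 0"
      using \<delta>(2)[of z] z by (auto simp: O'_def dist_commute)
    have "g (z + t *s v) = 0"
      using g0 t(2) sub[OF z t(1)] by blast
    then have "\<Phi> (z + t *s v) $ j = \<Phi> z $ j" for j
      using \<Phi>(7,8) gz by (cases "j = i") simp_all
    then have "\<Phi> (z + t *s v) = \<Phi> z"
      by (simp add: vec_eq_iff)
    then have line: "z + t *s v = z"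
      using homeomorphism_apply1[OF \<Phi>(4)] sub[OF z t(1)] sub0 z by (metis IntD2 subsetD)
    show "p z = 0"
      using t(2) unfolding line .
  qed
  have hom: "homeomorphism O' (\<Phi> ` O') \<Phi> \<Psi>"
    using sub0 by (intro homeomorphism_of_subsets[OF \<Phi>(4) _ order_refl refl]) blast
  have "openin (top_of_set U') O'"
    using O'(1) sub0 by (simp add: openin_open_eq[OF \<Phi>(1)])
  then have "openin (top_of_set W') (\<Phi> ` O')"
    by (rule homeomorphism_imp_open_map[OF \<Phi>(4)])
  then have opn: "open (\<Phi> ` O')" "\<Phi> ` O' \<subseteq> W'"
    using \<Phi>(3) by (auto simp: openin_open_eq)
  have hol: "holomorphic_Cn (\<lambda>w. \<Psi> w $ j) (\<Phi> ` O')" for j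
    using \<Phi>(6)[of j] opn(2) unfolding holomorphic_Cn_def by blast
  have img: "\<Phi> ` ({z. p z = 0} \<inter> O') = {w \<in> \<Phi> ` O'. \<forall>j. j \<notin> - {i} \<longrightarrow> w $ j = 0}"
    using iff \<Phi>(7) by auto
  have "card (- {i}) = CARD('n) - 1"
    by (simp add: Compl_eq_Diff_UNIV)
  then have "regular_point {z. p z = 0} (CARD('n) - 1) b"
    unfolding regular_point_def
    using O' opn(1) hom hol img b(2) polynomial_Cn_holomorphic[OF \<Phi>(5)]
    by (intro conjI exI[of _ O'] exI[of _ "\<Phi> ` O'"] exI[of _ \<Phi>] exI[of _ \<Psi>] exI[of _ "- {i}"]) simp_all
  then show ?thesis
    using b(1) by blast
qed

lemma hypersurface_pure_codim_1:
  fixes p :: "complex ^ 'n \<Rightarrow> complex"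
  assumes p: "polynomial_Cn p" "p z1 \<noteq> 0"
  shows "pure_codim_subvariety 1 {z. p z = 0}"
proof -
  have "analytic_subvariety {z. p z = 0}"
    unfolding analytic_subvariety_def
    by (rule allI, rule exI[of _ UNIV], rule exI[of _ "{p}"])
       (simp add: polynomial_Cn_holomorphic[OF p(1)])
  moreover have "dim_at {z. p z = 0} a = CARD('n) - 1" if a: "p a = 0" for a
    by (rule dim_at_eqI[OF hypersurface_regular_points_dense[OF p a] hypersurface_regular_point_dim[OF p]])
  ultimately show ?thesis
    by (simp add: pure_codim_subvariety_def pure_dim_def)
qed

text \<open>If \<open>|p z| > max |p|\<close> on \<open>X\<close>, then the hypersurface \<open>p = p z\<close> passes through \<open>z\<close> and misses \<open>X\<close>.
The full space, of codimension \<open>0\<close>, shows that \<open>X\<close> is nonempty.\<close>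

lemma k_rational_hull_subset_poly_hull:
  fixes X :: "(complex ^ 'n) set"
  assumes "1 \<le> k" and X: "compact X"
  shows "k_rational_hull k X \<subseteq> poly_hull X"
proof
  fix z assume z: "z \<in> k_rational_hull k X"
  have meets: "V \<inter> X \<noteq> {}" if "m \<le> k" "pure_codim_subvariety m V" "z \<in> V" for m V
    using z that unfolding k_rational_hull_def by blast
  have "X \<noteq> {}"
    using meets[OF _ pure_codim_subvariety_UNIV] by simp
  moreover have "cmod (p z) \<le> (SUP x\<in>X. cmod (p x))" if p: "polynomial_Cn p" for p
  proof (rule ccontr)
    assume less: "\<not> ?thesis"
    obtain B where "B \<ge> 1" "\<And>x. x \<in> X \<Longrightarrow> cmod (p x) \<le> B"
      using polynomial_Cn_bounded[OF p X] by blast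
    then have bdd: "bdd_above ((\<lambda>x. cmod (p x)) ` X)"
      by (intro bdd_aboveI2)
    have ne: "p x - p z \<noteq> 0" if "x \<in> X" for x
      using cSUP_upper[OF that bdd] less by auto
    obtain x1 where "x1 \<in> X"
      using \<open>X \<noteq> {}\<close> by blast
    have "pure_codim_subvariety 1 {x. p x - p z = 0}"
      using hypersurface_pure_codim_1[OF polynomial_Cn_diff[OF p polynomial_Cn_const] ne[OF \<open>x1 \<in> X\<close>]] .
    then have "{x. p x - p z = 0} \<inter> X \<noteq> {}"
      using assms(1) by (intro meets) auto
    then show False
      using ne by blast
  qed
  ultimately show "z \<in> poly_hull X"
    by (simp add: poly_hull_def)
qed

section \<open>One-point Gleason parts in hulls with dense invertibles\<close>

theorem theorem1p2:
  fixes S :: "(complex ^ 'n) set" and k :: nat and x0 :: "complex ^ 'n"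
  assumes "2 \<le> k" and "k \<le> CARD('n)"
    and "compact S"
    and "k_polynomial_hull k S - S \<noteq> {}"
    and "x0 \<in> k_polynomial_hull k S - S"
  shows "\<exists>X. X \<subseteq> S \<and> compact X \<and>
           x0 \<in> k_rational_hull (k - 1) X - X \<and>
           k_rational_hull (k - 1) X - X \<subseteq> poly_hull X - X \<and>
           one_point_gleason_part X x0 \<and>
           dense_invertibles X"
proof -
  obtain X where X: "X \<subseteq> S" "compact X"
    and meets: "\<And>V. closed V \<Longrightarrow> x0 \<in> poly_hull (S \<inter> V) \<Longrightarrow> V \<inter> X \<noteq> {}"
    and dense: "X \<noteq> {} \<Longrightarrow> dense_invertibles X"
    and part: "x0 \<in> poly_hull X \<Longrightarrow> one_point_gleason_part X x0"
    using compact_subset_from_tower[OF assms(3), of x0] by blast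
  have "V \<inter> X \<noteq> {}" if "m \<le> k - 1" "pure_codim_subvariety m V" "x0 \<in> V" for m V
  proof (rule meets)
    show "closed V"
      using that(2) by (intro analytic_subvariety_closed) (simp add: pure_codim_subvariety_def)
    show "x0 \<in> poly_hull (S \<inter> V)"
      using assms(5) that unfolding k_polynomial_hull_def by blast
  qed
  then have rational: "x0 \<in> k_rational_hull (k - 1) X"
    unfolding k_rational_hull_def by blast
  have sub: "k_rational_hull (k - 1) X \<subseteq> poly_hull X"
    using assms(1) by (intro k_rational_hull_subset_poly_hull X(2)) simp
  then have hull: "x0 \<in> poly_hull X"
    using rational by blast
  then have "X \<noteq> {}"
    by (simp add: poly_hull_def)
  moreover have "x0 \<notin> X"
    using X(1) assms(5) by blast
  ultimately show ?thesis
    using X rational sub part[OF hull] dense by (intro exI[of _ X]) blast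
qed

end
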